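(* Let $n$ be a positive integer. Regarded as hyperplane arrangements in $\mathbb{R}^n_0$, the arrangements $\mathrm{Shi}(n)$ and $\mathrm{Ish}(n)$ have the same number of chambers, namely $(n+1)^{n-1}$, and the same number of bounded chambers, namely $(n-1)^{n-1}$.
   Context: Write $x_1,\dots,x_n$ for the standard coordinates on $\mathbb{R}^n$. The Shi arrangement is $$\mathrm{Shi}(n)=\{\,x_i-x_j=a : 1\le i<j\le n,\ a\in\{0,1\}\,\},$$ and the Ish arrangement is $$\mathrm{Ish}(n)=\{\,x_i-x_j=0: 1\le i<j\le n\,\}\ \cup\ \{\,x_i-x_n=a : 1\le i\le n-1,\ a\in\{1,\dots,n-i\}\,\}.$$ All these hyperplanes are invariant under translation by $(1,1,\dots,1)$, so the arrangements are considered in the $(n-1)$-dimensional quotient space $\mathbb{R}^n_0=\mathbb{R}^n/\mathbb{R}(1,\dots,1)$. The chambers of an arrangement $\mathcal{A}$ in a real vector space $V$ are the connected components of $V\setminus\bigcup_{H\in\mathcal{A}}H$. For $n=1$ the convention $0^0=1$ is used. *)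

theory Defs
  imports "HOL-Analysis.Analysis"
begin

text \<open>
  The space \<open>\<real>\<^sup>n\<close> is the space of real functions on \<open>{1..n}\<close> (extensional, i.e. \<open>undefined\<close> outside
  \<open>{1..n}\<close>), with the product topology \<^term>\<open>powertop_real {1..n}\<close>.
\<close>

definition rn :: "nat \<Rightarrow> (nat \<Rightarrow> real) set" where
  "rn n = topspace (powertop_real {1..n})"

lemma rn_eq: "rn n = {1..n} \<rightarrow>\<^sub>E UNIV"
  by (simp add: rn_def)

definition translate :: "nat \<Rightarrow> real \<Rightarrow> (nat \<Rightarrow> real) \<Rightarrow> (nat \<Rightarrow> real)" where
  "translate n t x = (\<lambda>i\<in>{1..n}. x i + t)"

text \<open>
  A point of the quotient of \<open>\<real>\<^sup>n\<close> by the line spanned by \<open>(1, \<dots>, 1)\<close> is a coset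
  \<open>x + \<real>(1, \<dots>, 1)\<close>, and \<open>proj n\<close> is the canonical projection.
\<close>

definition proj :: "nat \<Rightarrow> (nat \<Rightarrow> real) \<Rightarrow> (nat \<Rightarrow> real) set" where
  "proj n x = range (\<lambda>t. translate n t x)"

definition rn0 :: "nat \<Rightarrow> (nat \<Rightarrow> real) set topology" where
  "rn0 n = topology (\<lambda>U. U \<subseteq> proj n ` rn n \<and>
                         openin (powertop_real {1..n}) {x \<in> rn n. proj n x \<in> U})"

text \<open>
  The quotient of the Euclidean norm: \<open>\<parallel>c\<parallel> = inf {\<parallel>x\<parallel> | x \<in> c}\<close>. The quotient is a
  finite-dimensional real vector space, so any norm on it gives the same bounded sets.
\<close>

definition rn0_norm :: "nat \<Rightarrow> (nat \<Rightarrow> real) set \<Rightarrow> real" where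
  "rn0_norm n c = (INF x\<in>c. L2_set x {1..n})"

definition rn0_bounded :: "nat \<Rightarrow> (nat \<Rightarrow> real) set set \<Rightarrow> bool" where
  "rn0_bounded n C \<longleftrightarrow> (\<exists>K. \<forall>c\<in>C. rn0_norm n c \<le> K)"

definition hyp :: "nat \<Rightarrow> nat \<Rightarrow> nat \<Rightarrow> real \<Rightarrow> (nat \<Rightarrow> real) set" where
  "hyp n i j a = {x \<in> rn n. x i - x j = a}"

definition Shi :: "nat \<Rightarrow> (nat \<Rightarrow> real) set set" where
  "Shi n = {hyp n i j a | i j a. 1 \<le> i \<and> i < j \<and> j \<le> n \<and> a \<in> {0, 1}}"

definition Ish :: "nat \<Rightarrow> (nat \<Rightarrow> real) set set" where
  "Ish n = {hyp n i j 0 | i j. 1 \<le> i \<and> i < j \<and> j \<le> n} \<union>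
           {hyp n i n (real a) | i a. 1 \<le> i \<and> i \<le> n - 1 \<and> a \<in> {1..n - i}}"

text \<open>
  The arrangement induced in the quotient by a translation-invariant arrangement in \<open>\<real>\<^sup>n\<close>.
\<close>

definition induced :: "nat \<Rightarrow> (nat \<Rightarrow> real) set set \<Rightarrow> (nat \<Rightarrow> real) set set set" where
  "induced n A = (\<lambda>H. proj n ` H) ` A"

definition chambers :: "'a topology \<Rightarrow> 'a set set \<Rightarrow> 'a set set" where
  "chambers V A = connected_components_of (subtopology V (topspace V - \<Union>A))"

lemma openin_rn0:
  "openin (rn0 n) U \<longleftrightarrow>
     U \<subseteq> proj n ` rn n \<and> openin (powertop_real {1..n}) {x \<in> rn n. proj n x \<in> U}"
proof -
  let ?P = "\<lambda>U. U \<subseteq> proj n ` rn n \<and> openin (powertop_real {1..n}) {x \<in> rn n. proj n x \<in> U}"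
  have "istopology ?P"
    unfolding istopology_def
  proof (intro conjI allI impI)
    fix S T assume S: "?P S" and T: "?P T"
    show "S \<inter> T \<subseteq> proj n ` rn n" using S by blast
    have "{x \<in> rn n. proj n x \<in> S \<inter> T} = {x \<in> rn n. proj n x \<in> S} \<inter> {x \<in> rn n. proj n x \<in> T}"
      by blast
    then show "openin (powertop_real {1..n}) {x \<in> rn n. proj n x \<in> S \<inter> T}"
      using S T by (simp only: openin_Int)
  next
    fix \<K> assume K: "\<forall>S\<in>\<K>. ?P S"
    show "\<Union>\<K> \<subseteq> proj n ` rn n" using K by blast
    have "{x \<in> rn n. proj n x \<in> \<Union>\<K>} = (\<Union>S\<in>\<K>. {x \<in> rn n. proj n x \<in> S})"
      by blast
    then show "openin (powertop_real {1..n}) {x \<in> rn n. proj n x \<in> \<Union>\<K>}"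
      using K by (simp only:) (blast intro: openin_Union)
  qed
  then show ?thesis
    unfolding rn0_def by (subst topology_inverse') (assumption, rule refl)
qed

lemma topspace_rn0: "topspace (rn0 n) = proj n ` rn n"
proof -
  have "{x \<in> rn n. proj n x \<in> proj n ` rn n} = topspace (powertop_real {1..n})"
    by (auto simp: rn_def)
  then have "openin (rn0 n) (proj n ` rn n)"
    unfolding openin_rn0 by (simp only: openin_topspace order_refl simp_thms)
  then show ?thesis
    using openin_rn0[of n "topspace (rn0 n)"] openin_subset by blast
qed

lemma quotient_map_proj: "quotient_map (powertop_real {1..n}) (rn0 n) (proj n)"
  unfolding quotient_map_def topspace_rn0 openin_rn0 rn_def[symmetric] by blast

lemma proj_eq_iff:
  assumes "x \<in> rn n" "y \<in> rn n"
  shows "proj n x = proj n y \<longleftrightarrow> (\<exists>t. y = translate n t x)"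
proof
  assume "proj n x = proj n y"
  moreover have "translate n 0 y = y"
    using assms(2) unfolding rn_eq translate_def add_0_right by (rule PiE_restrict)
  then have "y \<in> proj n y"
    unfolding proj_def by (metis rangeI)
  ultimately have "y \<in> proj n x" by simp
  then show "\<exists>t. y = translate n t x"
    by (auto simp: proj_def)
next
  assume "\<exists>t. y = translate n t x"
  then obtain t where y: "y = translate n t x" ..
  have eq: "translate n s y = translate n (s + t) x" for s
    unfolding y translate_def by (rule restrict_ext) simp
  have "translate n s x \<in> proj n y" for s
    unfolding proj_def using eq[of "s - t"] by (intro range_eqI[of _ _ "s - t"]) simp
  moreover have "translate n s y \<in> proj n x" for s
    unfolding eq proj_def by (rule rangeI)
  ultimately have "proj n x \<subseteq> proj n y" "proj n y \<subseteq> proj n x"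
    unfolding proj_def[of n x] proj_def[of n y] by blast+
  then show "proj n x = proj n y" ..
qed

lemma proj_in_hyp_iff:
  assumes "x \<in> rn n" "i \<in> {1..n}" "j \<in> {1..n}"
  shows "proj n x \<in> proj n ` hyp n i j a \<longleftrightarrow> x i - x j = a"
proof
  assume "proj n x \<in> proj n ` hyp n i j a"
  then obtain y where y: "y \<in> rn n" "y i - y j = a" "proj n x = proj n y"
    by (auto simp: hyp_def)
  then obtain t where "y = translate n t x"
    using proj_eq_iff assms(1) by blast
  then show "x i - x j = a"
    using y assms by (simp add: translate_def)
qed (use assms in \<open>auto simp: hyp_def\<close>)

end

theory Submission
  imports Defs "HOL-Computational_Algebra.Polynomial"
begin

text \<open>
  Both arrangements consist of hyperplanes \<open>x\<^sub>i - x\<^sub>j = a\<close> with integral \<open>a\<close>, so each of them is a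
  finite set \<open>E\<close> of weighted edges \<open>(i, j, a)\<close> on a vertex set \<open>V\<close> (a gain graph). Three numbers
  attached to \<open>(V, E)\<close> satisfy a deletion--contraction rule for an edge \<open>e = (i, j, a)\<close>, \<open>i \<noteq> j\<close>,
  where contraction substitutes \<open>x\<^sub>i = x\<^sub>j + a\<close> and removes the vertex \<open>i\<close>.

  \<^item> The number of regions: adding \<open>e\<close> cuts exactly those regions which meet the new hyperplane, and
    these correspond to the regions of the contraction.

  \<^item> The number of bounded regions, as long as \<open>E\<close> is connected on \<open>V\<close>. An unbounded region contains a
    ray in a direction \<open>\<Sum>\<^bsub>v\<in>S\<^esub> e\<^sub>v\<close> with \<open>S\<close> a proper nonempty subset of \<open>V\<close>; boundedness is therefore
    a strong connectivity condition (\<open>diff_bounded_cell_iff\<close>), and the rule becomes a statement about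
    cuts of a directed graph (\<open>bounded_cut\<close>). If \<open>e\<close> is a bridge, then no region is bounded.

  \<^item> The number of maps \<open>V \<rightarrow> \<int>/q\<close> avoiding all hyperplanes modulo \<open>q\<close>, with the opposite sign.

  Hence by induction on the number of edges the third number is a polynomial \<open>Q(q)\<close> for all large
  \<open>q\<close>, there are \<open>(-1)\<^bsup>|V|\<^esup> Q(-1)\<close> regions, and, if \<open>E\<close> is connected, \<open>(-1)\<^bsup>|V|-1\<^esup> Q(1)\<close> bounded
  regions. This is Zaslavsky's theorem for gain graphs, \<open>zaslavsky_charpoly\<close>. The polynomial \<open>Q\<close> is
  the characteristic polynomial on \<open>\<real>\<^sup>n\<close>, that is, \<open>q\<close> times the one on the quotient.

  It remains to see \<open>Q(q) = q (q - n)\<^bsup>n-1\<^esup>\<close> in both cases. For Ish, a greedy choice of the values at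
  \<open>n, 1, 2, \<dots>, n - 1\<close> (in this order) leaves \<open>q, q - n, q - n, \<dots>\<close> possibilities. For Shi, a
  colouring seats the labels \<open>1, \<dots>, n\<close> on a circle of \<open>q\<close> seats such that labels increase along every
  run of occupied seats; if one marks an empty seat, a seating is the same thing as an
  arbitrary distribution of the labels among the \<open>q - n\<close> gaps after the empty seats.
  Counting seatings with a marked empty seat in two ways gives \<open>(q - n) Q(q) = q (q - n)\<^sup>n\<close>.

  Finally, regions and chambers correspond: a region is open, convex and invariant under translation
  by \<open>(1, \<dots>, 1)\<close>, so the images of the regions in the quotient are its chambers
  (\<open>bij_betw_regions_chambers\<close>), and a chamber is bounded in the quotient norm if and only if all
  coordinate differences are bounded on the region (\<open>rn0_bounded_iff\<close>).
\<close>

section \<open>Regions of a gain graph arrangement\<close>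

text \<open>
  An edge \<open>(i, j, a)\<close> stands for the hyperplane \<open>x\<^sub>i - x\<^sub>j = a\<close>. Points are functions on the whole
  type of vertices; coordinates outside the vertices of \<open>E\<close> have no influence on the cells below.
\<close>

type_synonym 'v edge = "'v \<times> 'v \<times> int"

definition height :: "'v edge \<Rightarrow> ('v \<Rightarrow> real) \<Rightarrow> real" where
  "height = (\<lambda>(i, j, a) x. x i - x j - of_int a)"

lemma height_simp [simp]: "height (i, j, a) x = x i - x j - of_int a"
  by (simp add: height_def)

text \<open>
  For \<open>x\<close> off all hyperplanes this is the region of \<open>x\<close>; in general it is the relatively open face
  of \<open>x\<close>. Faces are needed to treat the part of a region inside a further hyperplane in the same
  way as the parts on its two sides.
\<close>

definition cell :: "'v edge set \<Rightarrow> ('v \<Rightarrow> real) \<Rightarrow> ('v \<Rightarrow> real) set" where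
  "cell E x = {y. \<forall>f\<in>E. sgn (height f y) = sgn (height f x)}"

definition generic :: "'v edge set \<Rightarrow> ('v \<Rightarrow> real) set" where
  "generic E = {x. \<forall>f\<in>E. height f x \<noteq> 0}"

definition regions :: "'v edge set \<Rightarrow> ('v \<Rightarrow> real) set set" where
  "regions E = cell E ` generic E"

text \<open>
  Boundedness modulo translation by \<open>(1, \<dots>, 1)\<close>, for the coordinates in \<open>V\<close>.
\<close>

definition diff_bounded :: "'v set \<Rightarrow> ('v \<Rightarrow> real) set \<Rightarrow> bool" where
  "diff_bounded V C \<longleftrightarrow> (\<exists>K. \<forall>y\<in>C. \<forall>u\<in>V. \<forall>v\<in>V. y u - y v \<le> K)"

lemma diff_bounded_subset: "diff_bounded V C \<Longrightarrow> D \<subseteq> C \<Longrightarrow> diff_bounded V D"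
  unfolding diff_bounded_def by blast

lemma self_in_cell [simp]: "x \<in> cell E x"
  by (simp add: cell_def)

lemma cell_eq:
  assumes "y \<in> cell E x"
  shows "cell E y = cell E x"
proof -
  have "sgn (height f y) = sgn (height f x)" if "f \<in> E" for f
    using assms that by (simp add: cell_def)
  then show ?thesis
    unfolding cell_def by (intro Collect_cong ball_cong refl) simp
qed

lemma cell_generic:
  assumes "y \<in> cell E x" "x \<in> generic E"
  shows "y \<in> generic E"
proof -
  have "height f y \<noteq> 0" if "f \<in> E" for f
  proof -
    have "sgn (height f y) = sgn (height f x)" "height f x \<noteq> 0"
      using assms that by (auto simp: cell_def generic_def)
    then show ?thesis by (metis sgn_zero_iff)
  qed
  then show ?thesis by (simp add: generic_def)
qed

lemma regionD:
  assumes "C \<in> regions E" "x \<in> C"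
  shows "x \<in> generic E" "cell E x = C"
  using assms cell_generic cell_eq unfolding regions_def by blast+

lemma region_nonempty: "C \<in> regions E \<Longrightarrow> C \<noteq> {}"
  unfolding regions_def using self_in_cell by blast

lemma finite_regions:
  assumes "finite E"
  shows "finite (regions E)"
proof (rule finite_subset)
  show "regions E \<subseteq> (\<lambda>p. {y. \<forall>f\<in>E. sgn (height f y) = (if f \<in> p then 1 else -1)}) ` Pow E"
  proof
    fix C assume "C \<in> regions E"
    then obtain x where x: "x \<in> generic E" "C = cell E x"
      by (auto simp: regions_def)
    \<comment> \<open>A region is determined by the set of edges on whose positive side it lies.\<close>
    have "C = {y. \<forall>f\<in>E. sgn (height f y) = (if f \<in> {f\<in>E. height f x > 0} then 1 else -1)}"
      using x by (auto simp: cell_def generic_def sgn_if)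
    then show "C \<in> (\<lambda>p. {y. \<forall>f\<in>E. sgn (height f y) = (if f \<in> p then 1 else -1)}) ` Pow E"
      by blast
  qed
qed (use assms in simp)

lemma height_segment:
  "height f (\<lambda>v. (1 - t) * x v + t * y v) = (1 - t) * height f x + t * height f y"
  by (cases f) (simp add: algebra_simps)

lemma cell_convex:
  assumes "x \<in> cell E z" "y \<in> cell E z" "0 \<le> t" "t \<le> 1"
  shows "(\<lambda>v. (1 - t) * x v + t * y v) \<in> cell E z"
proof -
  have *: "sgn ((1 - t) * p + t * q) = sgn r" if "sgn p = sgn r" "sgn q = sgn r" for p q r :: real
  proof (cases "t = 0 \<or> t = 1")
    case False
    then have t: "0 < t" "0 < 1 - t" using assms by auto
    consider "r > 0" | "r = 0" | "r < 0" by linarith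
    then show ?thesis
    proof cases
      case 1
      then have "p > 0" "q > 0" using that by (auto simp: sgn_if split: if_splits)
      then have "(1 - t) * p + t * q > 0" using t by (intro add_pos_pos mult_pos_pos)
      then show ?thesis using 1 by simp
    next
      case 2
      then show ?thesis using that by (auto simp: sgn_zero_iff)
    next
      case 3
      then have "p < 0" "q < 0" using that by (auto simp: sgn_if split: if_splits)
      then have "(1 - t) * p + t * q < 0" using t by (intro add_neg_neg mult_pos_neg)
      then show ?thesis using 3 by simp
    qed
  qed (use that in auto)
  then show ?thesis
    using assms unfolding cell_def mem_Collect_eq height_segment by blast
qed

text \<open>
  Regions are open; moving a single coordinate is enough to leave any further hyperplane in which
  that coordinate occurs.
\<close>

lemma nudge:
  assumes "finite E" "x \<in> generic E"
  obtains s where "s > 0" "\<And>r. \<bar>r\<bar> \<le> s \<Longrightarrow> x(i := x i + r) \<in> cell E x"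
proof -
  define s where "s = Min (insert 1 ((\<lambda>f. \<bar>height f x\<bar>) ` E)) / 2"
  have pos: "s > 0"
    unfolding s_def using assms by (auto simp: generic_def)
  have le: "s < \<bar>height f x\<bar>" if "f \<in> E" for f
  proof -
    have "Min (insert 1 ((\<lambda>f. \<bar>height f x\<bar>) ` E)) \<le> \<bar>height f x\<bar>"
      using assms that by (intro Min_le) auto
    then show ?thesis using pos unfolding s_def by linarith
  qed
  have "sgn (height f (x(i := x i + r))) = sgn (height f x)" if "\<bar>r\<bar> \<le> s" "f \<in> E" for f r
  proof -
    have "\<bar>height f (x(i := x i + r)) - height f x\<bar> \<le> \<bar>r\<bar>"
      by (cases f) auto
    then show ?thesis
      using le[OF that(2)] that(1) by (auto simp: sgn_if)
  qed
  then show ?thesis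
    using that[OF pos] by (auto simp: cell_def)
qed

section \<open>Deletion\<close>

abbreviation pos_side :: "'v edge \<Rightarrow> ('v \<Rightarrow> real) set" where
  "pos_side e \<equiv> {x. height e x > 0}"
abbreviation neg_side :: "'v edge \<Rightarrow> ('v \<Rightarrow> real) set" where
  "neg_side e \<equiv> {x. height e x < 0}"
abbreviation plane :: "'v edge \<Rightarrow> ('v \<Rightarrow> real) set" where
  "plane e \<equiv> {x. height e x = 0}"

lemma cell_insert:
  "height e x > 0 \<Longrightarrow> cell (insert e E) x = cell E x \<inter> pos_side e"
  "height e x < 0 \<Longrightarrow> cell (insert e E) x = cell E x \<inter> neg_side e"
  "height e x = 0 \<Longrightarrow> cell (insert e E) x = cell E x \<inter> plane e"
  by (auto simp: cell_def sgn_if split: if_splits)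

lemma regions_insert:
  "regions (insert e E) =
     (\<lambda>C. C \<inter> pos_side e) ` {C \<in> regions E. C \<inter> pos_side e \<noteq> {}} \<union>
     (\<lambda>C. C \<inter> neg_side e) ` {C \<in> regions E. C \<inter> neg_side e \<noteq> {}}" (is "?L = ?P \<union> ?N")
proof
  show "?L \<subseteq> ?P \<union> ?N"
  proof
    fix D assume "D \<in> ?L"
    then obtain x where x: "x \<in> generic (insert e E)" "D = cell (insert e E) x"
      by (auto simp: regions_def)
    then have xE: "cell E x \<in> regions E" "height e x \<noteq> 0"
      by (auto simp: generic_def regions_def)
    then consider "height e x > 0" | "height e x < 0" by linarith
    then show "D \<in> ?P \<union> ?N"
    proof cases
      case 1
      then have "D = cell E x \<inter> pos_side e" "cell E x \<inter> pos_side e \<noteq> {}"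
        using x cell_insert(1)[of e x] self_in_cell[of x E] by blast+
      then show ?thesis using xE by blast
    next
      case 2
      then have "D = cell E x \<inter> neg_side e" "cell E x \<inter> neg_side e \<noteq> {}"
        using x cell_insert(2)[of e x] self_in_cell[of x E] by blast+
      then show ?thesis using xE by blast
    qed
  qed
  show "?P \<union> ?N \<subseteq> ?L"
  proof
    fix D assume "D \<in> ?P \<union> ?N"
    then obtain C x where C: "C \<in> regions E" "x \<in> C"
      and D: "height e x > 0 \<and> D = C \<inter> pos_side e \<or> height e x < 0 \<and> D = C \<inter> neg_side e"
      by blast
    have "D = cell (insert e E) x" "x \<in> generic (insert e E)"
      using D regionD[OF C] cell_insert[of e x] by (auto simp: generic_def)
    then show "D \<in> ?L" by (auto simp: regions_def)
  qed
qed

lemma card_Collect_of_bool: "finite A \<Longrightarrow> card {x \<in> A. P x} = (\<Sum>x\<in>A. of_bool (P x))"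
  by (simp add: of_bool_def sum.If_cases Int_def)

text \<open>
  The common bookkeeping for counting all regions and for counting bounded regions: the regions
  for \<open>insert e E\<close> are the nonempty parts \<open>C \<inter> pos_side e\<close> and \<open>C \<inter> neg_side e\<close> of regions \<open>C\<close> for
  \<open>E\<close>, and these parts are pairwise different. A deletion rule for the property \<open>\<Phi>\<close> therefore only
  has to be checked for one region at a time.
\<close>

lemma card_regions_insert:
  assumes fin: "finite E"
    and local: "\<And>C. C \<in> regions E \<Longrightarrow>
       of_bool (C \<inter> pos_side e \<noteq> {} \<and> \<Phi> (C \<inter> pos_side e)) +
       of_bool (C \<inter> neg_side e \<noteq> {} \<and> \<Phi> (C \<inter> neg_side e)) =
       (of_bool (\<Phi> C) + of_bool (C \<inter> plane e \<noteq> {} \<and> \<Phi> (C \<inter> plane e)) :: nat)"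
  shows "card {D \<in> regions (insert e E). \<Phi> D} =
    card {C \<in> regions E. \<Phi> C} + card {C \<in> regions E. C \<inter> plane e \<noteq> {} \<and> \<Phi> (C \<inter> plane e)}"
proof -
  note finR = finite_regions[OF fin]
  let ?P = "{C \<in> regions E. C \<inter> pos_side e \<noteq> {} \<and> \<Phi> (C \<inter> pos_side e)}"
  let ?N = "{C \<in> regions E. C \<inter> neg_side e \<noteq> {} \<and> \<Phi> (C \<inter> neg_side e)}"
  have inj: "inj_on (\<lambda>C. C \<inter> U) {C \<in> regions E. C \<inter> U \<noteq> {} \<and> \<Phi> (C \<inter> U)}" for U
  proof (rule inj_onI)
    fix C D assume C: "C \<in> {C \<in> regions E. C \<inter> U \<noteq> {} \<and> \<Phi> (C \<inter> U)}"
      and D: "D \<in> {C \<in> regions E. C \<inter> U \<noteq> {} \<and> \<Phi> (C \<inter> U)}" and eq: "C \<inter> U = D \<inter> U"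
    then obtain x where "x \<in> C" "x \<in> D" by blast
    then show "C = D" using C D regionD(2)[of C E x] regionD(2)[of D E x] by simp
  qed
  have "{D \<in> regions (insert e E). \<Phi> D} = (\<lambda>C. C \<inter> pos_side e) ` ?P \<union> (\<lambda>C. C \<inter> neg_side e) ` ?N"
    unfolding regions_insert by blast
  then have "card {D \<in> regions (insert e E). \<Phi> D} =
      card ((\<lambda>C. C \<inter> pos_side e) ` ?P \<union> (\<lambda>C. C \<inter> neg_side e) ` ?N)"
    by (rule arg_cong)
  also have "\<dots> = card ((\<lambda>C. C \<inter> pos_side e) ` ?P) + card ((\<lambda>C. C \<inter> neg_side e) ` ?N)"
  proof (rule card_Un_disjoint)
    have False if eq: "C \<inter> pos_side e = D \<inter> neg_side e" and nonempty: "C \<inter> pos_side e \<noteq> {}" for C D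
    proof -
      obtain x where x: "x \<in> C \<inter> pos_side e" using nonempty by blast
      then have "x \<in> D \<inter> neg_side e" using eq by simp
      then show False using x by simp
    qed
    then show "((\<lambda>C. C \<inter> pos_side e) ` ?P) \<inter> ((\<lambda>C. C \<inter> neg_side e) ` ?N) = {}"
      by blast
  qed (use finR in auto)
  also have "\<dots> = card ?P + card ?N"
    using card_image[OF inj[of "pos_side e"]] card_image[OF inj[of "neg_side e"]] by argo
  also have "\<dots> = card {C \<in> regions E. \<Phi> C} +
      card {C \<in> regions E. C \<inter> plane e \<noteq> {} \<and> \<Phi> (C \<inter> plane e)}"
  proof -
    have "(\<Sum>C\<in>regions E. of_bool (C \<inter> pos_side e \<noteq> {} \<and> \<Phi> (C \<inter> pos_side e)) +
        of_bool (C \<inter> neg_side e \<noteq> {} \<and> \<Phi> (C \<inter> neg_side e))) =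
      (\<Sum>C\<in>regions E. of_bool (\<Phi> C) + of_bool (C \<inter> plane e \<noteq> {} \<and> \<Phi> (C \<inter> plane e)) :: nat)"
      by (rule sum.cong[OF refl local])
    then show ?thesis
      by (simp only: card_Collect_of_bool[OF finR] sum.distrib)
  qed
  finally show ?thesis .
qed

text \<open>
  By openness a point of a region on the hyperplane can be pushed to either side; by convexity the
  segment between points on different sides meets the hyperplane.
\<close>

lemma region_cut_iff:
  assumes fin: "finite E" and C: "C \<in> regions E" and ne: "i \<noteq> j"
  shows "C \<inter> pos_side (i, j, a) \<noteq> {} \<or> C \<inter> neg_side (i, j, a) \<noteq> {}"
    and "C \<inter> plane (i, j, a) \<noteq> {} \<longleftrightarrow>
      C \<inter> pos_side (i, j, a) \<noteq> {} \<and> C \<inter> neg_side (i, j, a) \<noteq> {}"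
proof -
  let ?e = "(i, j, a)"
  have both: "C \<inter> pos_side ?e \<noteq> {} \<and> C \<inter> neg_side ?e \<noteq> {}" if x: "x \<in> C" "height ?e x = 0" for x
  proof -
    obtain s where s: "s > 0" "\<And>r. \<bar>r\<bar> \<le> s \<Longrightarrow> x(i := x i + r) \<in> cell E x"
      using nudge[OF fin regionD(1)[OF C x(1)]] by blast
    have "x(i := x i + s) \<in> C" "x(i := x i + (- s)) \<in> C"
      using s(2)[of s] s(2)[of "- s"] s(1) regionD(2)[OF C x(1)] by auto
    moreover have "height ?e (x(i := x i + s)) > 0" "height ?e (x(i := x i + (- s))) < 0"
      using x(2) ne s(1) by auto
    ultimately show ?thesis by blast
  qed
  obtain x where x: "x \<in> C" using region_nonempty[OF C] by blast
  show "C \<inter> pos_side ?e \<noteq> {} \<or> C \<inter> neg_side ?e \<noteq> {}"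
    using both[OF x] x by (cases "height ?e x = 0") (auto simp: neq_iff)
  show "C \<inter> plane ?e \<noteq> {} \<longleftrightarrow> C \<inter> pos_side ?e \<noteq> {} \<and> C \<inter> neg_side ?e \<noteq> {}"
  proof
    assume "C \<inter> pos_side ?e \<noteq> {} \<and> C \<inter> neg_side ?e \<noteq> {}"
    then obtain y z where y: "y \<in> C" "height ?e y > 0" and z: "z \<in> C" "height ?e z < 0"
      by blast
    \<comment> \<open>The parameter at which the affine function along the segment vanishes.\<close>
    define t where "t = height ?e y / (height ?e y - height ?e z)"
    have t: "0 \<le> t" "t \<le> 1" "(1 - t) * height ?e y + t * height ?e z = 0"
      using y(2) z(2) by (auto simp: t_def divide_simps simp del: height_simp)
    have "y \<in> cell E y" "z \<in> cell E y" using z regionD(2)[OF C y(1)] by auto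
    then have "(\<lambda>v. (1 - t) * y v + t * z v) \<in> C"
      using cell_convex t regionD(2)[OF C y(1)] by blast
    moreover have "(\<lambda>v. (1 - t) * y v + t * z v) \<in> plane ?e"
      unfolding mem_Collect_eq height_segment by (rule t(3))
    ultimately show "C \<inter> plane ?e \<noteq> {}" by blast
  qed (use both in blast)
qed

section \<open>Bounded regions\<close>

text \<open>
  The indicator vector of \<open>S\<close> is a recession direction of the closure of the cell of \<open>x\<close>. Reading
  each inequality as an arc between its two vertices, this says that no arc leaves \<open>S\<close>.
\<close>

definition recession :: "'v edge set \<Rightarrow> ('v \<Rightarrow> real) \<Rightarrow> 'v set \<Rightarrow> bool" where
  "recession E x S \<longleftrightarrow> (\<forall>(i, j, a)\<in>E.
     (height (i, j, a) x \<ge> 0 \<longrightarrow> j \<in> S \<longrightarrow> i \<in> S) \<and> (height (i, j, a) x \<le> 0 \<longrightarrow> i \<in> S \<longrightarrow> j \<in> S))"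

text \<open>
  A recession direction given by a proper nonempty subset makes some coordinate difference
  unbounded. Conversely, the vertices \<open>v\<close> for which \<open>y u - y v\<close> is bounded above on the cell form
  a set closed under all arcs, since every arc bounds one difference; if only \<open>V\<close> itself is
  closed, then all differences are bounded.
\<close>

lemma diff_bounded_cell_iff:
  assumes V: "finite V" and EV: "E \<subseteq> V \<times> V \<times> UNIV"
  shows "diff_bounded V (cell E x) \<longleftrightarrow> (\<nexists>S. S \<subseteq> V \<and> S \<noteq> {} \<and> S \<noteq> V \<and> recession E x S)"
proof
  assume bd: "diff_bounded V (cell E x)"
  show "\<nexists>S. S \<subseteq> V \<and> S \<noteq> {} \<and> S \<noteq> V \<and> recession E x S"
  proof (rule notI, elim exE conjE)
    fix S assume S: "S \<subseteq> V" "S \<noteq> {}" "recession E x S" and "S \<noteq> V"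
    then obtain u v where uv: "u \<in> S" "v \<in> V" "v \<notin> S" using S by blast
    obtain K where K: "\<And>y. y \<in> cell E x \<Longrightarrow> y u - y v \<le> K"
      using bd uv S unfolding diff_bounded_def by blast
    define t where "t = max 0 (K - (x u - x v) + 1)"
    define y where "y = (\<lambda>w. if w \<in> S then x w + t else x w)"
    have t: "t \<ge> 0" by (simp add: t_def)
    have "y \<in> cell E x"
      unfolding cell_def
    proof (intro CollectI ballI)
      fix f assume f: "f \<in> E"
      obtain i j a where fe: "f = (i, j, a)" by (cases f)
      have "(height f x \<ge> 0 \<longrightarrow> j \<in> S \<longrightarrow> i \<in> S) \<and> (height f x \<le> 0 \<longrightarrow> i \<in> S \<longrightarrow> j \<in> S)"
        using S(3) f unfolding recession_def fe by fast
      then show "sgn (height f y) = sgn (height f x)"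
        using t unfolding fe by (auto simp: y_def sgn_if)
    qed
    then have "y u - y v \<le> K" by (rule K)
    then show False using uv by (simp add: y_def t_def max_def split: if_splits)
  qed
next
  have E: "i \<in> V \<and> j \<in> V" if "(i, j, a) \<in> E" for i j a
    using EV that by blast
  assume sc: "\<nexists>S. S \<subseteq> V \<and> S \<noteq> {} \<and> S \<noteq> V \<and> recession E x S"
  have "\<exists>K. \<forall>y\<in>cell E x. y u - y v \<le> K" if u: "u \<in> V" and v: "v \<in> V" for u v
  proof -
    define S where "S = {w \<in> V. \<exists>K. \<forall>y\<in>cell E x. y u - y w \<le> K}"
    have "u \<in> S" unfolding S_def using u by auto
    moreover have "i \<in> S" if e: "(i, j, a) \<in> E" and h: "height (i, j, a) x \<ge> 0" and "j \<in> S" for i j a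
    proof -
      obtain K where K: "\<And>y. y \<in> cell E x \<Longrightarrow> y u - y j \<le> K"
        using \<open>j \<in> S\<close> by (auto simp: S_def)
      have "y u - y i \<le> K - of_int a" if y: "y \<in> cell E x" for y
      proof -
        have "sgn (height (i, j, a) y) = sgn (height (i, j, a) x)" using y e unfolding cell_def by blast
        then have "height (i, j, a) y \<ge> 0" using h by (auto simp: sgn_if split: if_splits)
        then show ?thesis using K[OF y] by simp
      qed
      then show ?thesis using E[OF e] by (auto simp: S_def)
    qed
    moreover have "j \<in> S" if e: "(i, j, a) \<in> E" and h: "height (i, j, a) x \<le> 0" and "i \<in> S" for i j a
    proof -
      obtain K where K: "\<And>y. y \<in> cell E x \<Longrightarrow> y u - y i \<le> K"
        using \<open>i \<in> S\<close> by (auto simp: S_def)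
      have "y u - y j \<le> K + of_int a" if y: "y \<in> cell E x" for y
      proof -
        have "sgn (height (i, j, a) y) = sgn (height (i, j, a) x)" using y e unfolding cell_def by blast
        then have "height (i, j, a) y \<le> 0" using h by (auto simp: sgn_if split: if_splits)
        then show ?thesis using K[OF y] by simp
      qed
      then show ?thesis using E[OF e] by (auto simp: S_def)
    qed
    ultimately have "recession E x S" "u \<in> S"
      unfolding recession_def by blast+
    moreover have "S \<subseteq> V" by (auto simp: S_def)
    ultimately have "S = V" using sc by blast
    then show ?thesis using v unfolding S_def by blast
  qed
  then obtain K where K: "\<And>u v y. u \<in> V \<Longrightarrow> v \<in> V \<Longrightarrow> y \<in> cell E x \<Longrightarrow> y u - y v \<le> K u v"
    by metis
  have "y u - y v \<le> Max ((\<lambda>(u, v). K u v) ` (V \<times> V))" if "y \<in> cell E x" "u \<in> V" "v \<in> V" for y u v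
  proof -
    have "K u v \<le> Max ((\<lambda>(u, v). K u v) ` (V \<times> V))"
      using V that by (intro Max_ge) (auto intro!: rev_image_eqI[of "(u, v)"])
    then show ?thesis using K[of u v y] that by linarith
  qed
  then show "diff_bounded V (cell E x)"
    unfolding diff_bounded_def by blast
qed

text \<open>
  Connectedness is expressed by cuts instead of paths, which matches the form of
  \<open>diff_bounded_cell_iff\<close>.
\<close>

definition connected_on :: "'v set \<Rightarrow> 'v edge set \<Rightarrow> bool" where
  "connected_on V E \<longleftrightarrow>
     (\<forall>S\<subseteq>V. S \<noteq> {} \<longrightarrow> (\<forall>(i, j, a)\<in>E. i \<in> S \<longleftrightarrow> j \<in> S) \<longrightarrow> S = V)"

lemma recession_insert:
  "recession (insert (i, j, a) E) x S \<longleftrightarrow> recession E x S \<and>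
    (height (i, j, a) x \<ge> 0 \<longrightarrow> j \<in> S \<longrightarrow> i \<in> S) \<and> (height (i, j, a) x \<le> 0 \<longrightarrow> i \<in> S \<longrightarrow> j \<in> S)"
  unfolding recession_def by auto

lemma recession_cell:
  assumes "y \<in> cell E x"
  shows "recession E y S \<longleftrightarrow> recession E x S"
proof -
  have "height f y \<ge> 0 \<longleftrightarrow> height f x \<ge> 0" "height f y \<le> 0 \<longleftrightarrow> height f x \<le> 0" if "f \<in> E" for f
  proof -
    have "sgn (height f y) = sgn (height f x)" using assms that by (simp add: cell_def)
    then show "height f y \<ge> 0 \<longleftrightarrow> height f x \<ge> 0" "height f y \<le> 0 \<longleftrightarrow> height f x \<le> 0"
      by (auto simp: sgn_if split: if_splits)
  qed
  then show ?thesis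
    unfolding recession_def by blast
qed

text \<open>
  If the region \<open>C\<close> is cut by \<open>e\<close>, its two sides and its section with the hyperplane impose on \<open>C\<close>
  an additional arc between \<open>i\<^sub>0\<close> and \<open>j\<^sub>0\<close>, in one direction, in the other, or in both. Call a
  proper nonempty set of vertices closed if no arc leaves it; boundedness means that there is
  none. If \<open>C\<close> is unbounded, then a closed set \<open>S\<close> for \<open>C\<close> stays closed on at least one side, so
  at most one side is bounded. It remains to see that one side is bounded if the section is:
  otherwise there are closed sets \<open>S\<close> and \<open>T\<close>, one for each side, and each must separate the two
  endpoints. Then no arc leaves \<open>S \<inter> T\<close> or \<open>S \<union> T\<close>, and these sets do not separate the endpoints,
  so they must be \<open>{}\<close> and \<open>V\<close>. Hence \<open>S\<close> and \<open>T\<close> are complementary and no edge of \<open>E\<close> runs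
  between them, against connectedness.
\<close>

lemma bounded_cut:
  assumes fin: "finite E" and V: "finite V"
    and E: "insert (i0, j0, a0) E \<subseteq> V \<times> V \<times> UNIV"
    and ne: "i0 \<noteq> j0" and conn: "connected_on V E" and C: "C \<in> regions E"
  defines "e \<equiv> (i0, j0, a0)"
  shows "of_bool (C \<inter> pos_side e \<noteq> {} \<and> diff_bounded V (C \<inter> pos_side e)) +
       of_bool (C \<inter> neg_side e \<noteq> {} \<and> diff_bounded V (C \<inter> neg_side e)) =
       (of_bool (diff_bounded V C) + of_bool (C \<inter> plane e \<noteq> {} \<and> diff_bounded V (C \<inter> plane e)) :: nat)"
proof (cases "C \<inter> plane e = {}")
  case True
  have "C = (C \<inter> pos_side e) \<union> (C \<inter> neg_side e) \<union> (C \<inter> plane e)"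
    by (auto simp: neq_iff)
  then have parts: "C = (C \<inter> pos_side e) \<union> (C \<inter> neg_side e)"
    using True by simp
  from True consider "C \<inter> pos_side e = {}" "C \<inter> neg_side e \<noteq> {}" | "C \<inter> neg_side e = {}" "C \<inter> pos_side e \<noteq> {}"
    using region_cut_iff[OF fin C ne, of a0] unfolding e_def by blast
  then show ?thesis
  proof cases
    case 1
    then have "C \<inter> neg_side e = C" using parts by simp
    then show ?thesis using 1 True by simp
  next
    case 2
    then have "C \<inter> pos_side e = C" using parts by simp
    then show ?thesis using 2 True by simp
  qed
next
  case False
  then obtain x y z where x: "x \<in> C" "height e x > 0" and y: "y \<in> C" "height e y < 0" and z: "z \<in> C" "height e z = 0"
    using region_cut_iff[OF fin C ne, of a0] unfolding e_def by blast
  have Cx: "C = cell E x" using regionD[OF C] x by blast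
  let ?proper = "\<lambda>S. S \<subseteq> V \<and> S \<noteq> {} \<and> S \<noteq> V \<and> recession E x S"
  have rec: "recession E y = recession E x" "recession E z = recession E x"
    using recession_cell y z Cx by blast+
  have EV: "i \<in> V" "j \<in> V" if "(i, j, a) \<in> E" for i j a using E that by blast+
  have bC: "diff_bounded V C \<longleftrightarrow> (\<nexists>S. ?proper S)"
    using diff_bounded_cell_iff[OF V, of E x] E Cx by simp
  have pos: "C \<inter> pos_side e = cell (insert e E) x" and neg: "C \<inter> neg_side e = cell (insert e E) y"
    and pl: "C \<inter> plane e = cell (insert e E) z"
    using cell_insert(1)[OF x(2), of E] cell_insert(2)[OF y(2), of E] cell_insert(3)[OF z(2), of E]
      regionD(2)[OF C x(1)] regionD(2)[OF C y(1)] regionD(2)[OF C z(1)] by simp_all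
  have bdd: "diff_bounded V (cell (insert e E) w) \<longleftrightarrow>
      (\<nexists>S. S \<subseteq> V \<and> S \<noteq> {} \<and> S \<noteq> V \<and> recession (insert e E) w S)" for w
    using diff_bounded_cell_iff[OF V, of "insert e E" w] E unfolding e_def by blast
  note height_e = x(2) y(2) z(2)
  have bp: "diff_bounded V (C \<inter> pos_side e) \<longleftrightarrow> (\<nexists>S. ?proper S \<and> (j0 \<in> S \<longrightarrow> i0 \<in> S))"
    unfolding pos bdd using height_e unfolding e_def by (simp add: recession_insert)
  have bn: "diff_bounded V (C \<inter> neg_side e) \<longleftrightarrow> (\<nexists>S. ?proper S \<and> (i0 \<in> S \<longrightarrow> j0 \<in> S))"
    unfolding neg bdd using height_e unfolding e_def by (simp add: recession_insert rec)
  have b0: "diff_bounded V (C \<inter> plane e) \<longleftrightarrow> (\<nexists>S. ?proper S \<and> (i0 \<in> S \<longleftrightarrow> j0 \<in> S))"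
    unfolding pl bdd using height_e unfolding e_def by (auto simp: recession_insert rec)
  have one: "diff_bounded V (C \<inter> pos_side e) \<or> diff_bounded V (C \<inter> neg_side e)"
    if "diff_bounded V (C \<inter> plane e)"
  proof (rule ccontr)
    assume "\<not> ?thesis"
    then obtain S T where S: "?proper S" "j0 \<in> S \<longrightarrow> i0 \<in> S" and T: "?proper T" "i0 \<in> T \<longrightarrow> j0 \<in> T"
      unfolding bp bn by blast
    have ST: "i0 \<in> S" "j0 \<notin> S" "j0 \<in> T" "i0 \<notin> T" using that S T unfolding b0 by blast+
    have "recession E x (S \<inter> T)" "recession E x (S \<union> T)"
      using S T unfolding recession_def by fast+
    moreover have nobad: "S' = {} \<or> S' = V" if "S' \<subseteq> V" "recession E x S'" "i0 \<in> S' \<longleftrightarrow> j0 \<in> S'" for S'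
      using \<open>diff_bounded V (C \<inter> plane e)\<close> that unfolding b0 by blast
    ultimately have "S \<inter> T = {}" "S \<union> T = V"
      using nobad[of "S \<inter> T"] nobad[of "S \<union> T"] ST S(1) T(1) by blast+
    have "\<forall>(i, j, a)\<in>E. i \<in> S \<longleftrightarrow> j \<in> S"
    proof clarify
      fix i j a assume f: "(i, j, a) \<in> E"
      have r: "(height (i, j, a) x \<ge> 0 \<longrightarrow> j \<in> U \<longrightarrow> i \<in> U) \<and> (height (i, j, a) x \<le> 0 \<longrightarrow> i \<in> U \<longrightarrow> j \<in> U)"
        if "recession E x U" for U
        using that f unfolding recession_def by fast
      have "T = V - S" using \<open>S \<inter> T = {}\<close> \<open>S \<union> T = V\<close> by blast
      then have T: "i \<in> T \<longleftrightarrow> i \<notin> S" "j \<in> T \<longleftrightarrow> j \<notin> S" using EV[OF f] by blast+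
      have "recession E x S" "recession E x T" using S(1) \<open>?proper T\<close> by blast+
      from this[THEN r] linear[of 0 "height (i, j, a) x"] T show "i \<in> S \<longleftrightarrow> j \<in> S"
        by blast
    qed
    then show False using conn S(1) unfolding connected_on_def by blast
  qed
  show ?thesis
  proof (cases "diff_bounded V C")
    case True
    then have "diff_bounded V (C \<inter> U)" for U using diff_bounded_subset by blast
    then show ?thesis using x y z True by auto
  next
    case F: False
    have "\<not> (diff_bounded V (C \<inter> pos_side e) \<and> diff_bounded V (C \<inter> neg_side e))"
      using F unfolding bp bn bC by blast
    moreover have "diff_bounded V (C \<inter> plane e)" if "diff_bounded V (C \<inter> pos_side e) \<or> diff_bounded V (C \<inter> neg_side e)"
      using that unfolding bp bn b0 by blast
    moreover have "C \<inter> pos_side e \<noteq> {}" "C \<inter> neg_side e \<noteq> {}" using x y by blast+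
    ultimately show ?thesis
      using one F False by auto
  qed
qed

text \<open>
  A union \<open>S\<close> of components of \<open>E\<close> and its complement can be translated against each other, except
  that the hyperplane of the additional edge may block one of the two directions.
\<close>

lemma no_bounded_region_bridge:
  assumes V: "finite V" and E: "insert (i0, j0, a0) E \<subseteq> V \<times> V \<times> UNIV"
    and disc: "\<not> connected_on V E" and C: "C \<in> regions (insert (i0, j0, a0) E)"
  shows "\<not> diff_bounded V C"
proof -
  let ?E = "insert (i0, j0, a0) E"
  obtain S where S: "S \<subseteq> V" "S \<noteq> {}" "S \<noteq> V" "\<forall>(i, j, a)\<in>E. i \<in> S \<longleftrightarrow> j \<in> S"
    using disc unfolding connected_on_def by auto
  have S': "i \<in> S \<longleftrightarrow> j \<in> S" "i \<in> V" "j \<in> V" if "(i, j, a) \<in> E" for i j a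
    using S(4) E that by auto
  obtain x where x: "x \<in> C" using region_nonempty[OF C] by blast
  have Cx: "C = cell ?E x" and nz: "height (i0, j0, a0) x \<noteq> 0"
    using regionD[OF C x] by (auto simp: generic_def)
  have cl: "recession E x S" "recession E x (V - S)"
    unfolding recession_def using S' by auto
  have ij: "i0 \<in> V" "j0 \<in> V" using E by blast+
  have "recession ?E x S \<or> recession ?E x (V - S)"
    unfolding recession_insert using cl nz ij by auto
  moreover have "V - S \<subseteq> V" "V - S \<noteq> {}" "V - S \<noteq> V" using S by blast+
  ultimately have "\<exists>S. S \<subseteq> V \<and> S \<noteq> {} \<and> S \<noteq> V \<and> recession ?E x S"
    using S(1-3) by metis
  then show ?thesis
    using diff_bounded_cell_iff[OF V E, of x] Cx by simp
qed

section \<open>Contraction\<close>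

text \<open>
  The edge for the restriction of the hyperplane of \<open>(k, l, b)\<close> to \<open>x\<^sub>i = x\<^sub>j + a\<close>, with the
  coordinate \<open>x\<^sub>i\<close> eliminated. Loops may arise; the hyperplane of a loop with weight different
  from \<open>0\<close> is empty.
\<close>

fun contract :: "'v edge \<Rightarrow> 'v edge \<Rightarrow> 'v edge" where
  "contract (i, j, a) (k, l, b) =
     (if k = i then j else k, if l = i then j else l,
      b - (if k = i then a else 0) + (if l = i then a else 0))"

lemma height_contract: "height f (x(i := x j + of_int a)) = height (contract (i, j, a) f) x"
  by (cases f) auto

lemma height_contract_plane:
  assumes "height (i, j, a) x = 0" shows "height (contract (i, j, a) f) x = height f x"
proof -
  have "x(i := x j + of_int a) = x" using assms by auto
  then show ?thesis using height_contract[of f x i j a] by simp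
qed

text \<open>
  The map \<open>y \<mapsto> y(i := y j + a)\<close> parametrises the hyperplane, and every hyperplane of \<open>E\<close> pulls
  back to its contraction. So the regions of the contraction are the pullbacks of the regions that
  meet the hyperplane.
\<close>

lemma bij_betw_contract_regions:
  assumes ne: "i \<noteq> j"
  shows "bij_betw (\<lambda>C. {y. y(i := y j + of_int a) \<in> C})
     {C \<in> regions E. C \<inter> plane (i, j, a) \<noteq> {}} (regions (contract (i, j, a) ` E))"
    (is "bij_betw ?g ?A ?B")
proof -
  let ?c = "contract (i, j, a)"
  have key: "?g (cell E x) = cell (?c ` E) x" if "height (i, j, a) x = 0" for x
    using height_contract_plane[OF that] by (auto simp: cell_def height_contract)
  have gen: "x \<in> generic (?c ` E) \<longleftrightarrow> x \<in> generic E" if "height (i, j, a) x = 0" for x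
    using height_contract_plane[OF that] by (auto simp: generic_def)
  show ?thesis
  proof (rule bij_betw_imageI)
    show "inj_on ?g ?A"
    proof (rule inj_onI)
      fix C D assume C: "C \<in> ?A" and D: "D \<in> ?A" and eq: "?g C = ?g D"
      then obtain x where x: "x \<in> C" "height (i, j, a) x = 0" by blast
      have "x(i := x j + of_int a) = x" using x by auto
      then have "x \<in> ?g C" using x by simp
      then have "x \<in> ?g D" using eq by simp
      then have "x \<in> D" using \<open>x(i := x j + of_int a) = x\<close> by simp
      then show "C = D" using regionD(2)[of C E x] regionD(2)[of D E x] C D x by simp
    qed
    show "?g ` ?A = ?B"
    proof
      show "?g ` ?A \<subseteq> ?B"
      proof
        fix D assume "D \<in> ?g ` ?A"
        then obtain C x where D: "D = ?g C" and C: "C \<in> regions E" and x: "x \<in> C" "height (i, j, a) x = 0"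
          by blast
        have "?g C = cell (?c ` E) x" using key[of x] x regionD(2)[OF C x(1)] by simp
        moreover have "x \<in> generic (?c ` E)" using gen[of x] x regionD(1)[OF C x(1)] by simp
        ultimately show "D \<in> ?B" unfolding D by (simp add: regions_def)
      qed
      show "?B \<subseteq> ?g ` ?A"
      proof
        fix D assume "D \<in> ?B"
        then obtain y where y: "y \<in> generic (?c ` E)" "D = cell (?c ` E) y" by (auto simp: regions_def)
        define x where "x = y(i := y j + of_int a)"
        have z: "height (i, j, a) x = 0" using ne by (simp add: x_def)
        have "x \<in> generic E" using y(1) by (auto simp: generic_def x_def height_contract)
        then have "cell E x \<in> ?A" using z self_in_cell by (fastforce simp: regions_def simp del: height_simp)
        moreover have "D = ?g (cell E x)"
          unfolding y(2) by (auto simp: cell_def x_def height_contract)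
        ultimately show "D \<in> ?g ` ?A" by blast
      qed
    qed
  qed
qed

lemma diff_bounded_contract:
  assumes ne: "i \<noteq> j" and j: "j \<in> V"
  shows "diff_bounded (V - {i}) {y. y(i := y j + of_int a) \<in> C} \<longleftrightarrow> diff_bounded V (C \<inter> plane (i, j, a))"
proof
  assume "diff_bounded (V - {i}) {y. y(i := y j + of_int a) \<in> C}"
  then obtain K where K: "\<And>y u v. y(i := y j + of_int a) \<in> C \<Longrightarrow> u \<in> V - {i} \<Longrightarrow> v \<in> V - {i} \<Longrightarrow> y u - y v \<le> K"
    unfolding diff_bounded_def by blast
  have "x u - x v \<le> K + \<bar>of_int a\<bar>" if x: "x \<in> C \<inter> plane (i, j, a)" and uv: "u \<in> V" "v \<in> V" for x u v
  proof -
    have xi: "x i = x j + of_int a" using x by simp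
    then have "x(i := x j + of_int a) \<in> C" using x by (simp add: fun_upd_idem)
    note K = K[OF this]
    define u' where "u' = (if u = i then j else u)"
    define v' where "v' = (if v = i then j else v)"
    have mem: "u' \<in> V - {i}" "v' \<in> V - {i}" "j \<in> V - {i}"
      using uv j ne by (auto simp: u'_def v'_def)
    have K': "x u' - x v' \<le> K" "x j - x j \<le> K"
      by (rule K; rule mem)+
    show ?thesis
      using K' xi unfolding u'_def v'_def by (cases "u = i"; cases "v = i") auto
  qed
  then show "diff_bounded V (C \<inter> plane (i, j, a))" unfolding diff_bounded_def by blast
next
  assume "diff_bounded V (C \<inter> plane (i, j, a))"
  then obtain K where K: "\<And>y u v. y \<in> C \<inter> plane (i, j, a) \<Longrightarrow> u \<in> V \<Longrightarrow> v \<in> V \<Longrightarrow> y u - y v \<le> K"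
    unfolding diff_bounded_def by blast
  have "y u - y v \<le> K" if y: "y(i := y j + of_int a) \<in> C" and uv: "u \<in> V - {i}" "v \<in> V - {i}" for y u v
    using K[of "y(i := y j + of_int a)" u v] y uv ne by auto
  then show "diff_bounded (V - {i}) {y. y(i := y j + of_int a) \<in> C}" unfolding diff_bounded_def by blast
qed

theorem card_regions_deletion_contraction:
  assumes "finite E" "i \<noteq> j"
  shows "card (regions (insert (i, j, a) E)) = card (regions E) + card (regions (contract (i, j, a) ` E))"
proof -
  have "card {D \<in> regions (insert (i, j, a) E). True} = card {C \<in> regions E. True} +
        card {C \<in> regions E. C \<inter> plane (i, j, a) \<noteq> {} \<and> True}"
    using assms region_cut_iff[OF assms(1) _ assms(2), of _ a]
    by (intro card_regions_insert) (auto simp del: height_simp)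
  then show ?thesis
    using bij_betw_same_card[OF bij_betw_contract_regions[OF assms(2), of a E]] by (simp del: height_simp)
qed

text \<open>
  Connectedness of \<open>E\<close> is essential: if \<open>(i, j, a)\<close> is the only edge on two vertices, there are no
  bounded regions at all, although the contraction has one.
\<close>

theorem card_bounded_regions_deletion_contraction:
  assumes "finite E" "finite V" "insert (i, j, a) E \<subseteq> V \<times> V \<times> UNIV"
    and ne: "i \<noteq> j" and "connected_on V E"
  shows "card {C \<in> regions (insert (i, j, a) E). diff_bounded V C} =
    card {C \<in> regions E. diff_bounded V C} +
    card {C \<in> regions (contract (i, j, a) ` E). diff_bounded (V - {i}) C}"
proof -
  let ?g = "\<lambda>C. {y. y(i := y j + of_int a) \<in> C}"
  have j: "j \<in> V" using assms(3) by blast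
  note bij = bij_betw_contract_regions[OF ne, of a E]
  have "bij_betw ?g {C \<in> regions E. C \<inter> plane (i, j, a) \<noteq> {} \<and> diff_bounded V (C \<inter> plane (i, j, a))}
     {C \<in> regions (contract (i, j, a) ` E). diff_bounded (V - {i}) C}"
  proof (rule bij_betw_subset[OF bij])
    show "?g ` {C \<in> regions E. C \<inter> plane (i, j, a) \<noteq> {} \<and> diff_bounded V (C \<inter> plane (i, j, a))} =
      {C \<in> regions (contract (i, j, a) ` E). diff_bounded (V - {i}) C}"
      unfolding bij_betw_imp_surj_on[OF bij, symmetric]
      using diff_bounded_contract[OF ne j, of a] by auto
  qed blast
  then show ?thesis
    using card_regions_insert[OF assms(1) bounded_cut[OF assms]] bij_betw_same_card by simp
qed

text \<open>
  The cases without a genuinely new hyperplane: a loop, whose hyperplane is empty, and an edge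
  parallel to an edge of \<open>E\<close>.
\<close>

lemma regions_insert_redundant:
  assumes "\<And>x y. x \<in> generic E \<Longrightarrow> y \<in> cell E x \<Longrightarrow> height e x \<noteq> 0 \<and> sgn (height e y) = sgn (height e x)"
  shows "regions (insert e E) = regions E"
proof -
  have nz: "height e x \<noteq> 0" if "x \<in> generic E" for x
    using assms[OF that self_in_cell] by blast
  have "generic (insert e E) = generic E"
    using nz unfolding generic_def by blast
  moreover have "cell (insert e E) x = cell E x" if "x \<in> generic E" for x
  proof (rule antisym)
    show "cell (insert e E) x \<subseteq> cell E x" unfolding cell_def by blast
    have "y \<in> cell (insert e E) x" if "y \<in> cell E x" for y
      using assms[OF \<open>x \<in> generic E\<close> that] that unfolding cell_def by blast
    then show "cell E x \<subseteq> cell (insert e E) x" by blast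
  qed
  ultimately show ?thesis
    unfolding regions_def by (simp cong: image_cong_simp)
qed

section \<open>Colourings modulo \<open>q\<close>\<close>

lemma poly_eqI_eventually:
  fixes P Q :: "int poly"
  assumes "eventually (\<lambda>q. poly P (int q) = poly Q (int q)) sequentially"
  shows "P = Q"
proof (rule ccontr)
  assume "P \<noteq> Q"
  then have "finite {x. poly (P - Q) x = 0}" using poly_roots_finite[of "P - Q"] by simp
  moreover obtain N where N: "\<And>q. q \<ge> N \<Longrightarrow> poly P (int q) = poly Q (int q)"
    using assms unfolding eventually_sequentially by blast
  then have "int ` {N..} \<subseteq> {x. poly (P - Q) x = 0}" by auto
  ultimately have "finite (int ` {N..})" by (rule rev_finite_subset)
  then show False by (simp add: finite_image_iff infinite_Ici)
qed

text \<open>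
  Colours are represented by their residues in \<open>{0..<q}\<close>, and functions on \<open>V\<close> are extensional, so
  that colourings can be counted.
\<close>

definition colourings :: "nat \<Rightarrow> 'v set \<Rightarrow> 'v edge set \<Rightarrow> ('v \<Rightarrow> int) set" where
  "colourings q V E = {x \<in> V \<rightarrow>\<^sub>E {0..<int q}. \<forall>(i, j, a)\<in>E. \<not> int q dvd x i - x j - a}"

text \<open>
  Membership of \<open>x\<close> in the hyperplane of an edge modulo \<open>q\<close>; the counterpart of \<open>height f x = 0\<close>.
\<close>

definition monochromatic :: "nat \<Rightarrow> 'v edge \<Rightarrow> ('v \<Rightarrow> int) \<Rightarrow> bool" where
  "monochromatic q = (\<lambda>(i, j, a) x. int q dvd x i - x j - a)"

lemma monochromatic_simp [simp]: "monochromatic q (i, j, a) x \<longleftrightarrow> int q dvd x i - x j - a"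
  by (simp add: monochromatic_def)

lemma colourings_alt: "colourings q V E = {x \<in> V \<rightarrow>\<^sub>E {0..<int q}. \<forall>f\<in>E. \<not> monochromatic q f x}"
  unfolding colourings_def monochromatic_def by (simp add: case_prod_unfold)

lemma finite_colourings: "finite V \<Longrightarrow> finite (colourings q V E)"
  by (rule finite_subset[of _ "V \<rightarrow>\<^sub>E {0..<int q}"]) (auto simp: colourings_def intro: finite_PiE)

lemma monochromatic_contract:
  assumes "int q dvd x i - x j - a"
  shows "monochromatic q (contract (i, j, a) f) x \<longleftrightarrow> monochromatic q f x"
proof -
  obtain k l b where f: "f = (k, l, b)" by (cases f)
  \<comment> \<open>Contraction changes the value of an edge by a multiple of the value of the
    contracted edge.\<close>
  define m where "m = (if k = i then 1 else 0) - (if l = i then 1 else 0 :: int)"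
  define k' where "k' = (if k = i then j else k)"
  define l' where "l' = (if l = i then j else l)"
  define b' where "b' = b - (if k = i then a else 0) + (if l = i then a else 0)"
  have eq: "x k - x l - b = (x k' - x l' - b') + m * (x i - x j - a)"
    by (simp add: m_def k'_def l'_def b'_def)
  have "int q dvd m * (x i - x j - a)" using assms by simp
  then have "int q dvd x k - x l - b \<longleftrightarrow> int q dvd x k' - x l' - b'"
    unfolding eq by (rule dvd_add_left_iff)
  then show ?thesis
    by (simp add: f k'_def l'_def b'_def)
qed

lemma contract_edges_subset:
  assumes "insert (i, j, a) E \<subseteq> V \<times> V \<times> UNIV" "i \<noteq> j"
  shows "contract (i, j, a) ` E \<subseteq> (V - {i}) \<times> (V - {i}) \<times> UNIV"
  using assms by (auto split: if_splits)

text \<open>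
  On the hyperplane modulo \<open>q\<close> the colour of \<open>i\<close> is determined by the colour of \<open>j\<close>.
\<close>

lemma bij_betw_contract_colourings:
  assumes E: "insert (i, j, a) E \<subseteq> V \<times> V \<times> UNIV" and ne: "i \<noteq> j" and q: "q > 0"
  shows "bij_betw (\<lambda>x. restrict x (V - {i})) {x \<in> colourings q V E. int q dvd x i - x j - a}
    (colourings q (V - {i}) (contract (i, j, a) ` E))" (is "bij_betw ?r ?A ?B")
proof -
  define ext where "ext = (\<lambda>y::'a \<Rightarrow> int. y(i := (y j + a) mod int q))"
  have ij: "i \<in> V" "j \<in> V" using E by auto
  have cE: "contract (i, j, a) ` E \<subseteq> (V - {i}) \<times> (V - {i}) \<times> UNIV"
    by (rule contract_edges_subset[OF E ne])
  have res: "monochromatic q f (restrict x (V - {i})) \<longleftrightarrow> monochromatic q f x"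
    if "f \<in> contract (i, j, a) ` E" for f x
    using subsetD[OF cE that] by (cases f) simp
  have dvd_ext: "int q dvd ext y i - ext y j - a" for y
  proof -
    have "ext y i - ext y j - a = (y j + a) mod int q - (y j + a)" using ne by (simp add: ext_def)
    also have "int q dvd \<dots>" by (simp add: mod_eq_dvd_iff[symmetric])
    finally show ?thesis .
  qed
  show ?thesis
  proof (rule bij_betw_byWitness[where f' = ext])
    show "\<forall>x\<in>?A. ext (?r x) = x"
    proof
      fix x assume x: "x \<in> ?A"
      then have xi: "0 \<le> x i" "x i < int q" using ij unfolding colourings_def by auto
      have xP: "x \<in> V \<rightarrow>\<^sub>E {0..<int q}" using x unfolding colourings_def by blast
      have "int q dvd x i - (x j + a)" using x by (simp add: diff_diff_eq)
      then have "(x j + a) mod int q = x i" using xi by (simp add: mod_eq_dvd_iff[symmetric])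
      then show "ext (?r x) = x"
        unfolding ext_def using ij ne PiE_arb[OF xP] by (auto simp: fun_eq_iff)
    qed
    show "\<forall>y\<in>?B. ?r (ext y) = y"
      unfolding ext_def colourings_def by (auto simp: fun_eq_iff PiE_def extensional_def)
    show "?r ` ?A \<subseteq> ?B"
    proof clarify
      fix x assume x: "x \<in> colourings q V E" "int q dvd x i - x j - a"
      then show "?r x \<in> ?B"
        using monochromatic_contract[of q x i j a, OF x(2)] res
        unfolding colourings_alt by auto
    qed
    show "ext ` ?B \<subseteq> ?A"
    proof clarify
      fix y assume y: "y \<in> ?B"
      have P: "y \<in> V - {i} \<rightarrow>\<^sub>E {0..<int q}" using y unfolding colourings_def by blast
      have "ext y \<in> V \<rightarrow>\<^sub>E {0..<int q}"
        using P q ij unfolding ext_def by (auto simp: PiE_def Pi_def extensional_def)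
      moreover have "\<not> monochromatic q f (ext y)" if f: "f \<in> E" for f
      proof -
        have "?r (ext y) = y" using P unfolding ext_def by (auto simp: fun_eq_iff PiE_def extensional_def)
        then show ?thesis
          using y f res[of "contract (i, j, a) f" "ext y"] monochromatic_contract[of q "ext y" i j a f] dvd_ext[of y]
          unfolding colourings_alt by auto
      qed
      ultimately show "ext y \<in> colourings q V E \<and> int q dvd ext y i - ext y j - a"
        using dvd_ext unfolding colourings_alt by auto
    qed
  qed
qed

lemma card_colourings_deletion_contraction:
  assumes "finite V" "insert (i, j, a) E \<subseteq> V \<times> V \<times> UNIV" "i \<noteq> j" "q > 0"
  shows "card (colourings q V E) = card (colourings q V (insert (i, j, a) E)) +
    card (colourings q (V - {i}) (contract (i, j, a) ` E))"
proof -
  let ?M = "{x \<in> colourings q V E. int q dvd x i - x j - a}"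
  have "card (colourings q V (insert (i, j, a) E) \<union> ?M) =
      card (colourings q V (insert (i, j, a) E)) + card ?M"
  proof (rule card_Un_disjoint)
    show "finite (colourings q V (insert (i, j, a) E))" "finite ?M"
      using finite_colourings[OF assms(1)] by simp_all
    show "colourings q V (insert (i, j, a) E) \<inter> ?M = {}"
      unfolding colourings_def by auto
  qed
  moreover have "colourings q V (insert (i, j, a) E) \<union> ?M = colourings q V E"
    unfolding colourings_def by auto
  ultimately have "card (colourings q V E) = card (colourings q V (insert (i, j, a) E)) + card ?M"
    by simp
  then show ?thesis
    using bij_betw_same_card[OF bij_betw_contract_colourings[OF assms(2-4)]] by simp
qed

lemma shift_dvd_iff:
  "(q :: int) dvd (x + t) mod q - (y + t) mod q - a \<longleftrightarrow> q dvd x - y - a"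
proof -
  have eq: "(x + t) mod q - (y + t) mod q - a = x - y - a + q * ((y + t) div q - (x + t) div q)"
    by (simp add: minus_mult_div_eq_mod[symmetric] algebra_simps)
  show ?thesis unfolding eq by (rule dvd_add_left_iff) simp
qed

text \<open>
  If no edge of \<open>E\<close> leaves \<open>S\<close>, then rotating the colours on \<open>S\<close> maps colourings to colourings.
  The rotation changes the value of an edge leaving \<open>S\<close> by an arbitrary amount, so all residues of
  that value are equally frequent, and those with value \<open>0\<close> are counted by the contraction. Thus,
  if \<open>Q\<close> is the polynomial of the contraction, adding the bridge turns \<open>q \<cdot> Q(q)\<close> into
  \<open>(q - 1) \<cdot> Q(q)\<close>. This vanishes at \<open>q = 1\<close>, in accordance with the absence of bounded regions.
\<close>

lemma card_colourings_bridge: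
  assumes V: "finite V" and E: "insert (i, j, a) E \<subseteq> V \<times> V \<times> UNIV" and q: "q > 0"
    and S: "\<forall>(k, l, b)\<in>E. k \<in> S \<longleftrightarrow> l \<in> S" "i \<in> S" "j \<notin> S"
  shows "card (colourings q V E) = q * card (colourings q (V - {i}) (contract (i, j, a) ` E))"
proof -
  define sh where "sh = (\<lambda>t x. \<lambda>v\<in>V. if v \<in> S then (x v + t) mod int q else x v)"
  let ?M = "{x \<in> colourings q V E. int q dvd x i - x j - a}"
  have ij: "i \<in> V" "j \<in> V" using E by auto
  have sh_col: "sh t x \<in> colourings q V E" if x: "x \<in> colourings q V E" for t x
  proof -
    have "sh t x \<in> V \<rightarrow>\<^sub>E {0..<int q}"
      using x q unfolding sh_def colourings_def by auto
    moreover have "\<not> int q dvd sh t x k - sh t x l - b" if f: "(k, l, b) \<in> E" for k l b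
    proof -
      have kl: "k \<in> V" "l \<in> V" using E f by auto
      have kS: "k \<in> S \<longleftrightarrow> l \<in> S" using S(1) f by auto
      have "\<not> int q dvd x k - x l - b" using x f unfolding colourings_def by auto
      then show ?thesis using kl kS unfolding sh_def by (auto simp: shift_dvd_iff)
    qed
    ultimately show ?thesis unfolding colourings_def by auto
  qed
  have sh_sh: "sh t (sh (- t) x) = x" "sh (- t) (sh t x) = x" if x: "x \<in> V \<rightarrow>\<^sub>E {0..<int q}" for t x
  proof -
    have b: "0 \<le> x v" "x v < int q" if "v \<in> V" for v using x that by auto
    have u: "x v = undefined" if "v \<notin> V" for v using x that by auto
    show "sh t (sh (- t) x) = x" "sh (- t) (sh t x) = x"
      unfolding sh_def using b u by (auto simp: fun_eq_iff mod_simps)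
  qed
  have gap: "(sh t x i - sh t x j - a) mod int q = (x i - x j - a + t) mod int q" for t x
  proof -
    have "sh t x i - sh t x j - a = (x i + t) mod int q - x j - a"
      unfolding sh_def using ij S by simp
    then have "(sh t x i - sh t x j - a) mod int q = ((x i + t) - x j - a) mod int q"
      by (simp only: diff_diff_eq mod_diff_left_eq)
    then show ?thesis by (simp add: algebra_simps)
  qed
  have colP: "x \<in> V \<rightarrow>\<^sub>E {0..<int q}" if "x \<in> colourings q V E" for x
    using that unfolding colourings_def by blast
  define level where "level = (\<lambda>y. (y i - y j - a) mod int q)"
  have bij: "bij_betw (\<lambda>(t, x). sh t x) ({0..<int q} \<times> ?M) (colourings q V E)"
  proof (rule bij_betw_byWitness[where f' = "\<lambda>y. (level y, sh (- level y) y)"])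
    have "level (sh t x) = t \<and> sh (- t) (sh t x) = x" if t: "t \<in> {0..<int q}" and x: "x \<in> ?M" for t x
    proof -
      have "(x i - x j - a + t) mod int q = (0 + t) mod int q"
        using x by (intro mod_add_cong) auto
      then have "level (sh t x) = t" using t unfolding level_def gap by simp
      then show ?thesis using sh_sh(2)[OF colP] x by simp
    qed
    then show "\<forall>p\<in>{0..<int q} \<times> ?M. (level (case p of (t, x) \<Rightarrow> sh t x),
        sh (- level (case p of (t, x) \<Rightarrow> sh t x)) (case p of (t, x) \<Rightarrow> sh t x)) = p"
      by auto
    show "\<forall>y\<in>colourings q V E. (case (level y, sh (- level y) y) of (t, x) \<Rightarrow> sh t x) = y"
      using sh_sh(1)[OF colP] by simp
    show "(\<lambda>(t, x). sh t x) ` ({0..<int q} \<times> ?M) \<subseteq> colourings q V E"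
      using sh_col by auto
    have "level y \<in> {0..<int q} \<and> sh (- level y) y \<in> ?M" if y: "y \<in> colourings q V E" for y
    proof -
      have "(sh (- level y) y i - sh (- level y) y j - a) mod int q = 0"
        unfolding gap level_def by (simp only: add_uminus_conv_diff mod_diff_right_eq) simp
      then have "int q dvd sh (- level y) y i - sh (- level y) y j - a" by (rule mod_0_imp_dvd)
      then show ?thesis using sh_col[OF y] q by (simp add: level_def)
    qed
    then show "(\<lambda>y. (level y, sh (- level y) y)) ` colourings q V E \<subseteq> {0..<int q} \<times> ?M"
      by auto
  qed
  have "card (colourings q V E) = card ({0..<int q} \<times> ?M)"
    by (rule bij_betw_same_card[OF bij, symmetric])
  also have "\<dots> = q * card ?M" by (simp add: card_cartesian_product)
  finally show ?thesis
    using bij_betw_same_card[OF bij_betw_contract_colourings[OF E _ q]] S by auto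
qed

lemma card_PiE_colours: "finite V \<Longrightarrow> card (colourings q V {}) = q ^ card V"
  by (simp add: colourings_def card_PiE)

lemma connected_on_empty:
  assumes "V \<noteq> {}"
  shows "connected_on V {} \<longleftrightarrow> (\<exists>v. V = {v})"
proof
  obtain v where "v \<in> V" using assms by blast
  moreover assume "connected_on V {}"
  ultimately have "{v} = V"
    by (auto simp: connected_on_def dest!: spec[of _ "{v}"])
  then show "\<exists>v. V = {v}" by blast
qed (auto simp: connected_on_def)

text \<open>
  A set closed under the contracted edges lifts to one closed under the original edges, by giving
  \<open>i\<close> the same side as \<open>j\<close>.
\<close>

lemma connected_on_contract:
  assumes E: "insert (i, j, a) E \<subseteq> V \<times> V \<times> UNIV" and ne: "i \<noteq> j"
    and conn: "connected_on V (insert (i, j, a) E)"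
  shows "connected_on (V - {i}) (contract (i, j, a) ` E)"
  unfolding connected_on_def
proof (intro allI impI)
  fix S assume S: "S \<subseteq> V - {i}" "S \<noteq> {}"
    and cl: "\<forall>(k, l, b)\<in>contract (i, j, a) ` E. k \<in> S \<longleftrightarrow> l \<in> S"
  define T where "T = (if j \<in> S then insert i S else S)"
  have "k \<in> T \<longleftrightarrow> l \<in> T" if "(k, l, b) \<in> E" for k l b
  proof -
    have "(if k = i then j else k) \<in> S \<longleftrightarrow> (if l = i then j else l) \<in> S"
      using bspec[OF cl imageI[OF that]] by simp
    then show ?thesis using S(1) by (auto simp: T_def split: if_splits)
  qed
  moreover have "i \<in> T \<longleftrightarrow> j \<in> T" using S(1) ne by (auto simp: T_def)
  ultimately have "\<forall>(k, l, b)\<in>insert (i, j, a) E. k \<in> T \<longleftrightarrow> l \<in> T" by blast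
  moreover have "T \<subseteq> V" "T \<noteq> {}" using S E by (auto simp: T_def)
  ultimately have "T = V" using conn unfolding connected_on_def by blast
  then show "S = V - {i}" using S(1) by (auto simp: T_def split: if_splits)
qed

section \<open>Zaslavsky's theorem for gain graphs\<close>

definition bounded_count :: "'v set \<Rightarrow> 'v edge set \<Rightarrow> nat" where
  "bounded_count V E = card {C \<in> regions E. diff_bounded V C}"

text \<open>
  For small \<open>q\<close> different weights may coincide modulo \<open>q\<close>; for all large \<open>q\<close> the count is
  polynomial.
\<close>

definition is_charpoly :: "'v set \<Rightarrow> 'v edge set \<Rightarrow> int poly \<Rightarrow> bool" where
  "is_charpoly V E Q \<longleftrightarrow>
     eventually (\<lambda>q. int (card (colourings q V E)) = poly Q (int q)) sequentially"

text \<open>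
  The statement proved by induction. No claim on bounded regions is made if \<open>E\<close> is disconnected:
  then all regions are unbounded, while \<open>Q(1)\<close> need not be \<open>0\<close>, as the case of no edges shows.
\<close>

definition zaslavsky :: "'v set \<Rightarrow> 'v edge set \<Rightarrow> int poly \<Rightarrow> bool" where
  "zaslavsky V E Q \<longleftrightarrow> is_charpoly V E Q \<and>
     int (card (regions E)) = (- 1) ^ card V * poly Q (- 1) \<and>
     (connected_on V E \<longrightarrow> int (bounded_count V E) = (- 1) ^ (card V - 1) * poly Q 1)"

lemma zaslavsky_insert_redundant:
  assumes "zaslavsky V E Q" "regions (insert e E) = regions E"
    and "eventually (\<lambda>q. colourings q V (insert e E) = colourings q V E) sequentially"
    and "connected_on V (insert e E) \<longleftrightarrow> connected_on V E"
  shows "zaslavsky V (insert e E) Q"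
proof -
  have "is_charpoly V (insert e E) Q"
    using assms(1,3) unfolding zaslavsky_def is_charpoly_def by (auto elim: eventually_elim2)
  then show ?thesis
    using assms unfolding zaslavsky_def bounded_count_def by simp
qed

text \<open>
  The deletion--contraction rules for the three counts match, with the sign \<open>(-1)\<^bsup>|V|\<^esup>\<close> accounting
  for the lost vertex. If \<open>E\<close> is disconnected but becomes connected by the new edge, then this
  edge is a bridge; the polynomial of \<open>E\<close> is \<open>q\<close> times that of the contraction, and both sides of
  the claim on bounded regions are \<open>0\<close>.
\<close>

lemma zaslavsky_insert:
  assumes V: "finite V" and fin: "finite E" and EV: "insert (i, j, a) E \<subseteq> V \<times> V \<times> UNIV" and ne: "i \<noteq> j"
    and P: "zaslavsky V E P" and Q: "zaslavsky (V - {i}) (contract (i, j, a) ` E) Q"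
  shows "zaslavsky V (insert (i, j, a) E) (P - Q)"
proof -
  let ?E = "insert (i, j, a) E" and ?c = "contract (i, j, a) ` E"
  have ij: "i \<in> V" "j \<in> V" using EV by auto
  then have "card V \<ge> 2" using V ne by (metis card_2_iff card_mono empty_subsetI insert_subset)
  then obtain m where m: "card V = Suc (Suc m)" by (metis Suc_le_D numeral_2_eq_2 Suc_le_mono)
  have m': "card (V - {i}) = Suc m" using V ij m by simp
  have "eventually (\<lambda>q. int (card (colourings q V ?E)) = poly (P - Q) (int q)) sequentially"
    using P[unfolded zaslavsky_def is_charpoly_def, THEN conjunct1]
      Q[unfolded zaslavsky_def is_charpoly_def, THEN conjunct1] eventually_gt_at_top[of 0]
  proof eventually_elim
    case (elim q)
    then show ?case
      using card_colourings_deletion_contraction[OF V EV ne elim(3)] by simp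
  qed
  moreover have "int (card (regions ?E)) = (- 1) ^ card V * poly (P - Q) (- 1)"
    using P Q card_regions_deletion_contraction[OF fin ne, of a]
    unfolding zaslavsky_def m m' by (simp add: algebra_simps)
  moreover have "int (bounded_count V ?E) = (- 1) ^ (card V - 1) * poly (P - Q) 1"
    if conn: "connected_on V ?E"
  proof (cases "connected_on V E")
    case True
    then show ?thesis
      using P Q card_bounded_regions_deletion_contraction[OF fin V EV ne True]
        connected_on_contract[OF EV ne conn]
      unfolding zaslavsky_def m m' bounded_count_def by (simp add: algebra_simps)
  next
    case False
    then obtain S where S: "S \<subseteq> V" "S \<noteq> {}" "S \<noteq> V" "\<forall>(k, l, b)\<in>E. k \<in> S \<longleftrightarrow> l \<in> S"
      unfolding connected_on_def by auto
    have sep: "(i \<in> S) \<noteq> (j \<in> S)"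
    proof
      assume "(i \<in> S) = (j \<in> S)"
      then have "\<forall>(k, l, b)\<in>?E. k \<in> S \<longleftrightarrow> l \<in> S" using S(4) by blast
      then show False using conn S(1-3) unfolding connected_on_def by blast
    qed
    \<comment> \<open>The side of the cut that contains \<open>i\<close>, for rotating its colours.\<close>
    obtain T where T: "\<forall>(k, l, b)\<in>E. k \<in> T \<longleftrightarrow> l \<in> T" "i \<in> T" "j \<notin> T"
    proof (cases "i \<in> S")
      case True
      then show ?thesis using that[of S] S(4) sep by blast
    next
      case False
      then show ?thesis using that[of "- S"] S(4) sep by auto
    qed
    have "eventually (\<lambda>q. poly P (int q) = poly (pCons 0 Q) (int q)) sequentially"
      using P[unfolded zaslavsky_def is_charpoly_def, THEN conjunct1]
        Q[unfolded zaslavsky_def is_charpoly_def, THEN conjunct1] eventually_gt_at_top[of 0]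
    proof eventually_elim
      case (elim q)
      then show ?case
        using card_colourings_bridge[OF V EV elim(3) T] by simp
    qed
    then have "P = pCons 0 Q" by (rule poly_eqI_eventually)
    moreover have "bounded_count V ?E = 0"
      using no_bounded_region_bridge[OF V EV False] unfolding bounded_count_def by (simp add: card_eq_0_iff)
    ultimately show ?thesis by simp
  qed
  ultimately show ?thesis
    unfolding zaslavsky_def is_charpoly_def by blast
qed

lemma zaslavsky_empty:
  assumes "finite V" "V \<noteq> {}"
  shows "zaslavsky V {} (monom 1 (card V))"
proof -
  have "regions {} = {UNIV :: ('a \<Rightarrow> real) set}"
    by (simp add: regions_def cell_def generic_def)
  moreover have "bounded_count V {} = 1 \<and> card V = 1" if conn: "connected_on V {}"
  proof -
    obtain v where v: "V = {v}" using conn assms(2) by (auto simp: connected_on_empty)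
    have "{C \<in> regions {}. diff_bounded V C} = {UNIV}"
      unfolding v \<open>regions {} = {UNIV}\<close> by (auto simp: diff_bounded_def)
    then show ?thesis by (simp add: bounded_count_def v)
  qed
  ultimately show ?thesis
    unfolding zaslavsky_def is_charpoly_def card_PiE_colours[OF assms(1)]
    by (auto simp: poly_monom power_mult_distrib[symmetric])
qed

lemma regions_insert_parallel:
  assumes "f \<in> E" "c \<noteq> 0" "\<And>x. height e x = c * height f x"
  shows "regions (insert e E) = regions E"
  by (rule regions_insert_redundant) (use assms in \<open>auto simp: generic_def cell_def sgn_mult\<close>)

text \<open>
  Induction on the number of edges. A loop of weight \<open>0\<close> would be satisfied everywhere and is
  excluded; contracting \<open>(i, j, a)\<close> produces such a loop only from the edge itself or from
  \<open>(j, i, -a)\<close>, which describes the same hyperplane and makes the edge redundant.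
\<close>

lemma ex_zaslavsky:
  assumes "finite V" "V \<noteq> {}" "finite E" "E \<subseteq> V \<times> V \<times> UNIV" "\<And>i. (i, i, 0) \<notin> E"
  shows "\<exists>Q. zaslavsky V E Q"
  using assms
proof (induction "card E" arbitrary: V E rule: less_induct)
  case less
  show ?case
  proof (cases "E = {}")
    case True
    then show ?thesis using zaslavsky_empty less.prems by blast
  next
    case False
    then obtain i j a where e: "(i, j, a) \<in> E" by auto
    define F where "F = E - {(i, j, a)}"
    have E: "E = insert (i, j, a) F" and eF: "(i, j, a) \<notin> F" using e by (auto simp: F_def)
    have F: "finite F" "F \<subseteq> V \<times> V \<times> UNIV" "\<And>i. (i, i, 0) \<notin> F"
      using less.prems by (auto simp: F_def)
    have card: "card F < card E" using less.prems(3) e unfolding F_def by (rule card_Diff1_less)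
    obtain P where P: "zaslavsky V F P"
      using less.hyps[OF card less.prems(1,2) F] by blast
    consider "i = j" | "i \<noteq> j" "(j, i, - a) \<in> F" | "i \<noteq> j" "(j, i, - a) \<notin> F" by blast
    then show ?thesis
    proof cases
      case 1
      have a: "a \<noteq> 0" using e 1 less.prems(5) by blast
      have "regions E = regions F"
        unfolding E by (rule regions_insert_redundant) (use 1 a in simp)
      moreover have "eventually (\<lambda>q. colourings q V E = colourings q V F) sequentially"
        using eventually_gt_at_top[of "nat \<bar>a\<bar>"]
      proof eventually_elim
        case (elim q)
        have "\<not> int q dvd - a" using elim a zdvd_imp_le[of "int q" "\<bar>a\<bar>"] by auto
        then show ?case unfolding E colourings_def using 1 by auto
      qed
      moreover have "connected_on V E \<longleftrightarrow> connected_on V F"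
        unfolding E connected_on_def using 1 by simp
      ultimately have "zaslavsky V E P"
        using zaslavsky_insert_redundant[OF P, of "(i, j, a)"] unfolding E by blast
      then show ?thesis by blast
    next
      case 2
      have "regions E = regions F"
        unfolding E by (rule regions_insert_parallel[OF 2(2), of "-1"]) simp_all
      moreover have "colourings q V E = colourings q V F" for q
      proof -
        have "int q dvd x i - x j - a \<longleftrightarrow> int q dvd x j - x i - (- a)" for x
          using dvd_minus_iff[of "int q" "x i - x j - a"] by (simp add: algebra_simps)
        then show ?thesis unfolding E colourings_def using 2(2) by fastforce
      qed
      moreover have "connected_on V E \<longleftrightarrow> connected_on V F"
      proof -
        have "(\<forall>(k, l, b)\<in>E. k \<in> S \<longleftrightarrow> l \<in> S) \<longleftrightarrow> (\<forall>(k, l, b)\<in>F. k \<in> S \<longleftrightarrow> l \<in> S)" for S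
          unfolding E using 2(2) by auto
        then show ?thesis unfolding connected_on_def by simp
      qed
      ultimately have "zaslavsky V E P"
        using zaslavsky_insert_redundant[OF P, of "(i, j, a)"] unfolding E by simp
      then show ?thesis by blast
    next
      case 3
      let ?c = "contract (i, j, a) ` F"
      have EV: "insert (i, j, a) F \<subseteq> V \<times> V \<times> UNIV" using less.prems(4) E by simp
      have "(k, k, 0) \<notin> ?c" for k
      proof
        assume "(k, k, 0) \<in> ?c"
        then obtain k' l' b where f: "(k', l', b) \<in> F" and c: "contract (i, j, a) (k', l', b) = (k, k, 0)"
          by (metis imageE prod_cases3)
        have "k' = l' \<and> b = 0 \<or> (k', l', b) = (i, j, a) \<or> (k', l', b) = (j, i, - a)"
          using c 3(1) by (auto split: if_splits)
        then show False using f F(3) eF 3(2) by blast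
      qed
      moreover have "card ?c < card E" using card card_image_le[OF F(1), of "contract (i, j, a)"] by linarith
      moreover have "V - {i} \<noteq> {}" using EV 3(1) by auto
      ultimately obtain Q where "zaslavsky (V - {i}) ?c Q"
        using less.hyps[of ?c "V - {i}"] less.prems(1) F(1) contract_edges_subset[OF EV 3(1)] by blast
      then show ?thesis
        using zaslavsky_insert[OF less.prems(1) F(1) EV 3(1) P] unfolding E by blast
    qed
  qed
qed

text \<open>
  The polynomial is determined by its values at large integers, so any polynomial that counts
  colourings can be used.
\<close>

theorem zaslavsky_charpoly:
  assumes "finite V" "V \<noteq> {}" "finite E" "E \<subseteq> V \<times> V \<times> UNIV" "\<And>i. (i, i, 0) \<notin> E"
    and Q: "is_charpoly V E Q"
  shows "int (card (regions E)) = (- 1) ^ card V * poly Q (- 1)"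
    and "connected_on V E \<Longrightarrow> int (bounded_count V E) = (- 1) ^ (card V - 1) * poly Q 1"
proof -
  obtain P where P: "zaslavsky V E P" using ex_zaslavsky[OF assms(1-5)] by blast
  have "eventually (\<lambda>q. poly P (int q) = poly Q (int q)) sequentially"
    using P[unfolded zaslavsky_def is_charpoly_def, THEN conjunct1] Q[unfolded is_charpoly_def]
    by eventually_elim simp
  then have "P = Q" by (rule poly_eqI_eventually)
  then show "int (card (regions E)) = (- 1) ^ card V * poly Q (- 1)"
    and "connected_on V E \<Longrightarrow> int (bounded_count V E) = (- 1) ^ (card V - 1) * poly Q 1"
    using P unfolding zaslavsky_def by blast+
qed

section \<open>Chambers in the quotient space\<close>

text \<open>
  Each member of the partition is also closed, because its complement is the union of the others.
\<close>

lemma connected_components_of_open_partition: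
  assumes cover: "\<Union>\<U> = topspace X"
    and piece: "\<And>U. U \<in> \<U> \<Longrightarrow> openin X U \<and> connectedin X U \<and> U \<noteq> {}"
    and disj: "\<And>U W. U \<in> \<U> \<Longrightarrow> W \<in> \<U> \<Longrightarrow> U \<inter> W \<noteq> {} \<Longrightarrow> U = W"
  shows "connected_components_of X = \<U>"
proof -
  have comp: "Collect (connected_component_of X x) = U" if U: "U \<in> \<U>" and x: "x \<in> U" for U x
  proof
    show "U \<subseteq> Collect (connected_component_of X x)"
      using piece[OF U] x by (intro connected_component_of_maximal) simp_all
    have "topspace X - U = \<Union>(\<U> - {U})"
      using cover disj U by blast
    moreover have "openin X (\<Union>(\<U> - {U}))"
      using piece by (intro openin_Union) blast
    ultimately have cl: "closedin X U"
      using piece[OF U] openin_subset[of X U] by (simp add: closedin_def)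
    have "connectedin X (Collect (connected_component_of X x))"
      by (rule connectedin_connected_component_of)
    moreover have "x \<in> Collect (connected_component_of X x)"
      using cover U x by (simp add: connected_component_of_refl) blast
    ultimately show "Collect (connected_component_of X x) \<subseteq> U"
      using connectedin_clopen_cases[of X _ U] cl piece[OF U] x by (meson disjnt_iff)
  qed
  show ?thesis
  proof
    show "connected_components_of X \<subseteq> \<U>"
    proof
      fix K assume "K \<in> connected_components_of X"
      then obtain x where "x \<in> topspace X" "K = Collect (connected_component_of X x)"
        unfolding connected_components_of_def by blast
      then show "K \<in> \<U>" using cover comp by blast
    qed
    show "\<U> \<subseteq> connected_components_of X"
    proof
      fix U assume U: "U \<in> \<U>"
      then obtain x where x: "x \<in> U" using piece by blast
      then have "x \<in> topspace X" using cover U by blast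
      then show "U \<in> connected_components_of X"
        unfolding connected_components_of_def using comp[OF U x] by blast
    qed
  qed
qed

text \<open>
  Cells only depend on the coordinates in \<open>V\<close>, and only modulo translation; in particular
  \<open>restrict\<close> does not leave a cell.
\<close>

lemma cell_translate:
  assumes E: "E \<subseteq> V \<times> V \<times> UNIV" and y: "\<And>v. v \<in> V \<Longrightarrow> y v = x v + t"
  shows "y \<in> cell E z \<longleftrightarrow> x \<in> cell E z"
proof -
  have "height f y = height f x" if "f \<in> E" for f
    using subsetD[OF E that] y by (cases f) auto
  then show ?thesis by (simp add: cell_def)
qed

lemma restrict_in_rn: "restrict x {1..n} \<in> rn n"
  by (simp add: rn_eq)

lemma continuous_map_height:
  assumes "i \<in> {1..n}" "j \<in> {1..n}"
  shows "continuous_map (powertop_real {1..n}) euclideanreal (height (i, j, a))"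
proof -
  have "continuous_map (powertop_real {1..n}) euclideanreal (\<lambda>x. x i - x j - of_int a)"
    using assms by (intro continuous_map_diff continuous_map_product_projection continuous_map_const[THEN iffD2]) auto
  then show ?thesis by (simp add: height_def)
qed

text \<open>
  Off the hyperplanes a cell is a finite intersection of open half-spaces.
\<close>

lemma openin_cell:
  assumes "finite E" "E \<subseteq> {1..n} \<times> {1..n} \<times> UNIV" "z \<in> generic E"
  shows "openin (powertop_real {1..n}) (cell E z \<inter> rn n)"
  using assms
proof (induction E rule: finite_induct)
  case empty
  have "cell {} z \<inter> rn n = topspace (powertop_real {1..n})"
    unfolding cell_def rn_def by simp
  then show ?case by (simp only: openin_topspace)
next
  case (insert f E)
  obtain i j a where f: "f = (i, j, a)" by (cases f)
  have ij: "i \<in> {1..n}" "j \<in> {1..n}" using insert.prems(1) f by auto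
  have nz: "height f z \<noteq> 0" using insert.prems(2) by (simp add: generic_def)
  define U where "U = (if height f z > 0 then {0<..} else {..<0 :: real})"
  have "openin (powertop_real {1..n}) {x \<in> topspace (powertop_real {1..n}). height f x \<in> U}"
    unfolding f using continuous_map_height[OF ij]
    by (rule openin_continuous_map_preimage) (simp add: U_def)
  moreover have "openin (powertop_real {1..n}) (cell E z \<inter> rn n)"
    using insert.IH insert.prems by (simp add: generic_def)
  moreover have "cell (insert f E) z \<inter> rn n =
      (cell E z \<inter> rn n) \<inter> {x \<in> topspace (powertop_real {1..n}). height f x \<in> U}"
  proof (cases "height f z > 0")
    case True
    then show ?thesis unfolding cell_insert(1)[OF True] U_def rn_def by auto
  next
    case False
    then have "height f z < 0" using nz by simp
    then show ?thesis unfolding cell_insert(2)[OF \<open>height f z < 0\<close>] U_def rn_def using False by auto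
  qed
  ultimately show ?case by (simp only: openin_Int)
qed

lemma connectedin_cell:
  assumes E: "E \<subseteq> {1..n} \<times> {1..n} \<times> UNIV"
  shows "connectedin (powertop_real {1..n}) (cell E z \<inter> rn n)"
proof (rule path_connectedin_imp_connectedin)
  have "\<exists>g. pathin (subtopology (powertop_real {1..n}) (cell E z \<inter> rn n)) g \<and> g 0 = x \<and> g 1 = y"
    if x: "x \<in> cell E z \<inter> rn n" and y: "y \<in> cell E z \<inter> rn n" for x y
  proof -
    define g where "g = (\<lambda>t::real. \<lambda>v\<in>{1..n}. (1 - t) * x v + t * y v)"
    have "g t \<in> cell E z" if "t \<in> {0..1}" for t
    proof -
      have "(\<lambda>v. (1 - t) * x v + t * y v) \<in> cell E z"
        using x y that by (intro cell_convex) auto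
      then show ?thesis
        using cell_translate[OF E, of "g t" "\<lambda>v. (1 - t) * x v + t * y v" 0 z] by (simp add: g_def)
    qed
    moreover have "g t \<in> rn n" for t unfolding g_def by (rule restrict_in_rn)
    moreover have "continuous_map (top_of_set {0..1}) (powertop_real {1..n}) g"
      unfolding continuous_map_componentwise
    proof (intro conjI ballI)
      show "g ` topspace (top_of_set {0..1}) \<subseteq> extensional {1..n}"
        by (auto simp: g_def)
      fix k assume "k \<in> {1..n}"
      then have "(\<lambda>t. g t k) = (\<lambda>t. (1 - t) * x k + t * y k)" by (simp add: g_def)
      then show "continuous_map (top_of_set {0..1}) euclideanreal (\<lambda>t. g t k)"
        by (auto intro!: continuous_intros)
    qed
    ultimately have "pathin (subtopology (powertop_real {1..n}) (cell E z \<inter> rn n)) g"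
      unfolding pathin_def continuous_map_in_subtopology by auto
    moreover have "g 0 = x" "g 1 = y"
      using x y unfolding g_def rn_eq by (auto simp: fun_eq_iff PiE_def extensional_def)
    ultimately show ?thesis by blast
  qed
  then show "path_connectedin (powertop_real {1..n}) (cell E z \<inter> rn n)"
    unfolding path_connectedin_def path_connected_space_def by (auto simp: rn_def)
qed

text \<open>
  Cells are saturated for the projection, as they are invariant under translation.
\<close>

lemma proj_in_cell_image_iff:
  assumes E: "E \<subseteq> {1..n} \<times> {1..n} \<times> UNIV" and x: "x \<in> rn n"
  shows "proj n x \<in> proj n ` (cell E z \<inter> rn n) \<longleftrightarrow> x \<in> cell E z"
proof
  assume "proj n x \<in> proj n ` (cell E z \<inter> rn n)"
  then obtain y where y: "y \<in> cell E z" "y \<in> rn n" "proj n x = proj n y" by blast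
  then obtain t where "y = translate n t x" using proj_eq_iff[OF x y(2)] by blast
  then have "y v = x v + t" if "v \<in> {1..n}" for v using that by (simp add: translate_def)
  then show "x \<in> cell E z" using cell_translate[OF E] y(1) by blast
qed (use x in blast)

text \<open>
  A coset of small quotient norm has a representative with small coordinates, hence small
  differences. For the converse, the representative with first coordinate \<open>0\<close> has the differences
  as its coordinates.
\<close>

lemma rn0_bounded_iff:
  assumes E: "E \<subseteq> {1..n} \<times> {1..n} \<times> UNIV" and n: "n \<ge> 1"
  shows "rn0_bounded n (proj n ` (cell E z \<inter> rn n)) \<longleftrightarrow> diff_bounded {1..n} (cell E z)"
proof
  assume "rn0_bounded n (proj n ` (cell E z \<inter> rn n))"
  then obtain K where K: "\<And>y. y \<in> cell E z \<Longrightarrow> y \<in> rn n \<Longrightarrow> rn0_norm n (proj n y) \<le> K"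
    unfolding rn0_bounded_def by blast
  have "x u - x v \<le> 2 * (K + 1)" if x: "x \<in> cell E z" and u: "u \<in> {1..n}" and v: "v \<in> {1..n}" for x u v
  proof -
    define y where "y = restrict x {1..n}"
    have y: "y \<in> rn n" unfolding y_def by (rule restrict_in_rn)
    have yc: "y \<in> cell E z" using cell_translate[OF E, of y x 0 z] x by (simp add: y_def)
    have "(INF w\<in>proj n y. L2_set w {1..n}) < K + 1"
      using K[OF yc y] unfolding rn0_norm_def by linarith
    moreover have "bdd_below ((\<lambda>w. L2_set w {1..n}) ` proj n y)"
      by (rule bdd_belowI[of _ 0]) (auto simp: L2_set_nonneg)
    moreover have "proj n y \<noteq> {}" by (auto simp: proj_def)
    ultimately obtain w where w: "w \<in> proj n y" "L2_set w {1..n} < K + 1"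
      by (subst (asm) cINF_less_iff) auto
    then obtain t where t: "w = translate n t y" by (auto simp: proj_def)
    have "\<bar>w k\<bar> \<le> K + 1" if "k \<in> {1..n}" for k
      using member_le_L2_set[of "{1..n}" k "\<lambda>i. \<bar>w i\<bar>"] w(2) that by (simp add: L2_set_def)
    then have "w u - w v \<le> 2 * (K + 1)" using u v by (smt (verit))
    then show ?thesis using u v unfolding t translate_def y_def by simp
  qed
  then show "diff_bounded {1..n} (cell E z)" unfolding diff_bounded_def by blast
next
  assume "diff_bounded {1..n} (cell E z)"
  then obtain K where K: "\<And>y u v. y \<in> cell E z \<Longrightarrow> u \<in> {1..n} \<Longrightarrow> v \<in> {1..n} \<Longrightarrow> y u - y v \<le> K"
    unfolding diff_bounded_def by blast
  have "rn0_norm n (proj n y) \<le> real n * K" if y: "y \<in> cell E z" "y \<in> rn n" for y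
  proof -
    define w where "w = translate n (- y 1) y"
    have "rn0_norm n (proj n y) \<le> L2_set w {1..n}"
      unfolding rn0_norm_def
    proof (rule cINF_lower)
      show "bdd_below ((\<lambda>w. L2_set w {1..n}) ` proj n y)"
        by (rule bdd_belowI[of _ 0]) (auto simp: L2_set_nonneg)
      show "w \<in> proj n y" by (auto simp: w_def proj_def)
    qed
    also have "\<dots> \<le> (\<Sum>i\<in>{1..n}. \<bar>w i\<bar>)" by (rule L2_set_le_sum_abs)
    also have "\<dots> \<le> (\<Sum>i\<in>{1..n}. K)"
    proof (rule sum_mono)
      fix i assume i: "i \<in> {1..n}"
      then have "y i - y 1 \<le> K" "y 1 - y i \<le> K" using K y n by auto
      then show "\<bar>w i\<bar> \<le> K" using i by (simp add: w_def translate_def)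
    qed
    finally show ?thesis by simp
  qed
  then show "rn0_bounded n (proj n ` (cell E z \<inter> rn n))"
    unfolding rn0_bounded_def by blast
qed

definition arrangement :: "nat \<Rightarrow> nat edge set \<Rightarrow> (nat \<Rightarrow> real) set set" where
  "arrangement n E = (\<lambda>(i, j, a). hyp n i j (of_int a)) ` E"

lemma proj_in_induced_iff:
  assumes E: "E \<subseteq> {1..n} \<times> {1..n} \<times> UNIV" and x: "x \<in> rn n"
  shows "proj n x \<in> \<Union>(induced n (arrangement n E)) \<longleftrightarrow> x \<notin> generic E"
proof -
  have "proj n x \<in> proj n ` hyp n i j (of_int a) \<longleftrightarrow> height (i, j, a) x = 0" if "(i, j, a) \<in> E" for i j a
  proof -
    have "i \<in> {1..n}" "j \<in> {1..n}" using E that by auto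
    then show ?thesis using proj_in_hyp_iff[OF x] by auto
  qed
  then show ?thesis
    unfolding induced_def arrangement_def generic_def by (fastforce simp del: height_simp)
qed

text \<open>
  The images of the regions are open, connected and disjoint and cover the complement of the
  hyperplanes.
\<close>

lemma bij_betw_regions_chambers:
  assumes fin: "finite E" and E: "E \<subseteq> {1..n} \<times> {1..n} \<times> UNIV"
  shows "bij_betw (\<lambda>C. proj n ` (C \<inter> rn n)) (regions E) (chambers (rn0 n) (induced n (arrangement n E)))"
proof -
  let ?g = "\<lambda>C. proj n ` (C \<inter> rn n)"
  let ?A = "induced n (arrangement n E)"
  let ?X = "subtopology (rn0 n) (topspace (rn0 n) - \<Union>?A)"
  have top: "topspace ?X = proj n ` (rn n \<inter> generic E)"
    using proj_in_induced_iff[OF E] by (auto simp: topspace_rn0)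
  have mem: "proj n x \<in> ?g C \<longleftrightarrow> x \<in> C" if "x \<in> rn n" "C \<in> regions E" for x C
    using that proj_in_cell_image_iff[OF E] by (auto simp: regions_def)
  have rep: "restrict x {1..n} \<in> C \<inter> rn n" if "C \<in> regions E" "x \<in> C" for x C
    using cell_translate[OF E, of "restrict x {1..n}" x 0 x] regionD(2)[OF that] that(2)
      restrict_in_rn[of x n] by simp
  have same: "C = D" if C: "C \<in> regions E" and D: "D \<in> regions E" and ne: "?g C \<inter> ?g D \<noteq> {}" for C D
  proof -
    obtain x where "x \<in> C" "x \<in> rn n" "proj n x \<in> ?g D" using ne by blast
    then have "x \<in> C" "x \<in> D" using mem D by auto
    then show ?thesis using regionD(2) C D by metis
  qed
  have ne: "?g C \<noteq> {}" if C: "C \<in> regions E" for C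
    using region_nonempty[OF C] rep[OF C] by blast
  have sub: "?g C \<subseteq> topspace ?X" if C: "C \<in> regions E" for C
    unfolding top using regionD(1)[OF C] by blast
  have "chambers (rn0 n) ?A = ?g ` regions E"
    unfolding chambers_def
  proof (rule connected_components_of_open_partition)
    show "\<Union>(?g ` regions E) = topspace ?X"
    proof
      show "topspace ?X \<subseteq> \<Union>(?g ` regions E)"
        unfolding top
      proof clarify
        fix x assume "x \<in> rn n" "x \<in> generic E"
        then have "cell E x \<in> regions E" "proj n x \<in> ?g (cell E x)" by (auto simp: regions_def)
        then show "proj n x \<in> \<Union>(?g ` regions E)" by blast
      qed
    qed (use sub in blast)
  next
    fix U assume "U \<in> ?g ` regions E"
    then obtain C z where C: "C \<in> regions E" "U = ?g C" and z: "z \<in> generic E" "C = cell E z"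
      by (auto simp: regions_def)
    have "{x \<in> rn n. proj n x \<in> U} = cell E z \<inter> rn n"
      using mem[OF _ C(1)] C(2) z(2) by blast
    then have "openin (rn0 n) U"
      unfolding openin_rn0 using openin_cell[OF fin E z(1)] C(2) by (simp only: ) blast
    moreover have sU: "U \<subseteq> topspace (rn0 n) - \<Union>?A"
      using sub[OF C(1)] C(2) by (simp add: topspace_subtopology)
    moreover have "connectedin (rn0 n) U"
      unfolding C(2) z(2)
      using connectedin_continuous_map_image[OF quotient_imp_continuous_map[OF quotient_map_proj]
        connectedin_cell[OF E]] .
    moreover have "U \<noteq> {}" using ne[OF C(1)] C(2) by blast
    ultimately show "openin ?X U \<and> connectedin ?X U \<and> U \<noteq> {}"
      unfolding openin_subtopology connectedin_subtopology by blast
  next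
    fix U W assume "U \<in> ?g ` regions E" "W \<in> ?g ` regions E" "U \<inter> W \<noteq> {}"
    then show "U = W" using same by blast
  qed
  moreover have "inj_on ?g (regions E)"
  proof (rule inj_onI)
    fix C D assume C: "C \<in> regions E" and D: "D \<in> regions E" and "?g C = ?g D"
    then show "C = D" using same[OF C D] ne[OF C] by simp
  qed
  ultimately show ?thesis unfolding bij_betw_def by simp
qed

lemma card_chambers:
  assumes fin: "finite E" and E: "E \<subseteq> {1..n} \<times> {1..n} \<times> UNIV" and n: "n \<ge> 1"
  shows "card (chambers (rn0 n) (induced n (arrangement n E))) = card (regions E)"
    and "card {C \<in> chambers (rn0 n) (induced n (arrangement n E)). rn0_bounded n C} = bounded_count {1..n} E"
proof -
  let ?g = "\<lambda>C. proj n ` (C \<inter> rn n)"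
  note bij = bij_betw_regions_chambers[OF fin E]
  show "card (chambers (rn0 n) (induced n (arrangement n E))) = card (regions E)"
    using bij_betw_same_card[OF bij] by simp
  have bd: "rn0_bounded n (?g C) \<longleftrightarrow> diff_bounded {1..n} C" if "C \<in> regions E" for C
    using that rn0_bounded_iff[OF E n] by (auto simp: regions_def)
  have bij': "bij_betw ?g {C \<in> regions E. diff_bounded {1..n} C}
      {C \<in> chambers (rn0 n) (induced n (arrangement n E)). rn0_bounded n C}"
  proof (rule bij_betw_subset[OF bij])
    show "?g ` {C \<in> regions E. diff_bounded {1..n} C} =
        {C \<in> chambers (rn0 n) (induced n (arrangement n E)). rn0_bounded n C}"
      unfolding bij_betw_imp_surj_on[OF bij, symmetric] using bd by auto
  qed blast
  show "card {C \<in> chambers (rn0 n) (induced n (arrangement n E)). rn0_bounded n C} = bounded_count {1..n} E"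
    unfolding bounded_count_def by (rule bij_betw_same_card[OF bij', symmetric])
qed

section \<open>Counting colourings for Ish\<close>

definition shi_edges :: "nat \<Rightarrow> nat edge set" where
  "shi_edges n = {(i, j, a). 1 \<le> i \<and> i < j \<and> j \<le> n \<and> a \<in> {0, 1}}"

definition ish_edges :: "nat \<Rightarrow> nat edge set" where
  "ish_edges n = {(i, j, a). 1 \<le> i \<and> i < j \<and> j \<le> n \<and> a = 0} \<union>
     {(i, j, a). 1 \<le> i \<and> i < n \<and> j = n \<and> a \<in> {1..int (n - i)}}"

lemma dvd_diff_iff_eq_mod:
  assumes "0 \<le> (u :: int)" "u < q"
  shows "q dvd u - w \<longleftrightarrow> u = w mod q"
  using assms by (simp add: mod_eq_dvd_iff[symmetric])

text \<open>
  Greedy counting: every partial colouring in \<open>X\<close> has exactly \<open>m\<close> extensions to the additional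
  point \<open>k\<close>.
\<close>

lemma card_PiE_extend:
  assumes k: "k \<notin> A" and X: "X \<subseteq> A \<rightarrow>\<^sub>E B" "finite X" and Y: "Y \<subseteq> insert k A \<rightarrow>\<^sub>E B"
    and iff: "\<And>x c. x \<in> A \<rightarrow>\<^sub>E B \<Longrightarrow> c \<in> B \<Longrightarrow> x(k := c) \<in> Y \<longleftrightarrow> x \<in> X \<and> c \<in> F x"
    and F: "\<And>x. x \<in> X \<Longrightarrow> F x \<subseteq> B \<and> finite (F x) \<and> card (F x) = m"
  shows "card Y = card X * m"
proof -
  have "Y = (\<lambda>(x, c). x(k := c)) ` Sigma X F"
  proof
    show "Y \<subseteq> (\<lambda>(x, c). x(k := c)) ` Sigma X F"
    proof
      fix y assume y: "y \<in> Y"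
      then have yP: "y \<in> insert k A \<rightarrow>\<^sub>E B" using Y by blast
      define x where "x = y(k := undefined)"
      have x: "x \<in> A \<rightarrow>\<^sub>E B" using yP k unfolding x_def by (auto simp: PiE_def Pi_def extensional_def)
      have c: "y k \<in> B" using yP by auto
      have "x(k := y k) = y" by (simp add: x_def)
      moreover from this have "x \<in> X" "y k \<in> F x" using iff[OF x c] y by simp_all
      ultimately show "y \<in> (\<lambda>(x, c). x(k := c)) ` Sigma X F"
        by (intro image_eqI[of _ _ "(x, y k)"]) auto
    qed
    show "(\<lambda>(x, c). x(k := c)) ` Sigma X F \<subseteq> Y"
    proof clarify
      fix x c assume x: "x \<in> X" and c: "c \<in> F x"
      then have "x \<in> A \<rightarrow>\<^sub>E B" "c \<in> B" using X(1) F[OF x] by blast+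
      then show "x(k := c) \<in> Y" using iff x c by simp
    qed
  qed
  moreover have "inj_on (\<lambda>(x, c). x(k := c)) (Sigma X F)"
  proof (rule inj_onI, clarify)
    fix x c x' c' assume x: "x \<in> X" "x' \<in> X" and eq: "x(k := c) = x'(k := c')"
    have "x k = undefined" "x' k = undefined" using x X(1) k by (auto simp: PiE_def extensional_def)
    then have "x v = x' v" for v using fun_cong[OF eq, of v] by (cases "v = k") auto
    then show "x = x' \<and> c = c'" using fun_cong[OF eq, of k] by auto
  qed
  ultimately have "card Y = card (Sigma X F)" by (simp add: card_image)
  also have "\<dots> = card X * m" using F X(2) by (simp add: card_SigmaI)
  finally show ?thesis .
qed

definition block :: "nat \<Rightarrow> int \<Rightarrow> nat \<Rightarrow> int set" where
  "block q c m = (\<lambda>a. (c + int a) mod int q) ` {0..m}"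

lemma card_block:
  assumes "m < q"
  shows "card (block q c m) = Suc m"
proof -
  have "inj_on (\<lambda>a. (c + int a) mod int q) {0..m}"
  proof (rule inj_onI)
    fix a b assume ab: "a \<in> {0..m}" "b \<in> {0..m}" and "(c + int a) mod int q = (c + int b) mod int q"
    then have "int q dvd int a - int b" by (simp add: mod_eq_dvd_iff)
    moreover have "\<bar>int a - int b\<bar> < int q" using ab assms by auto
    ultimately show "a = b" using dvd_imp_le_int[of "int a - int b" "int q"] by force
  qed
  then show ?thesis by (simp add: block_def card_image)
qed

lemma block_mono: "m \<le> m' \<Longrightarrow> block q c m \<subseteq> block q c m'"
  by (auto simp: block_def)

lemma block_subset: "q > 0 \<Longrightarrow> block q c m \<subseteq> {0..<int q}"
  by (auto simp: block_def)

text \<open>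
  Admissible values at \<open>n\<close> and \<open>1, \<dots>, k\<close>. The offset \<open>0\<close> in each block is the condition that the
  value differs from the one at \<open>n\<close>.
\<close>

definition ish_partial :: "nat \<Rightarrow> nat \<Rightarrow> nat \<Rightarrow> (nat \<Rightarrow> int) set" where
  "ish_partial q n k = {x \<in> insert n {1..k} \<rightarrow>\<^sub>E {0..<int q}.
     inj_on x {1..k} \<and> (\<forall>i\<in>{1..k}. x i \<notin> block q (x n) (n - i))}"

lemma finite_ish_partial: "finite (ish_partial q n k)"
  by (rule finite_subset[of _ "insert n {1..k} \<rightarrow>\<^sub>E {0..<int q}"])
     (auto simp: ish_partial_def intro: finite_PiE)

text \<open>
  The value at \<open>k + 1\<close> has to avoid the \<open>k\<close> earlier values and a block of length \<open>n - k\<close>. These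
  are \<open>n\<close> different values, because the earlier ones avoid larger blocks with the same start. So
  there are always \<open>q - n\<close> choices.
\<close>

lemma card_ish_partial:
  assumes "k < n" "n < q"
  shows "card (ish_partial q n k) = q * (q - n) ^ k"
  using assms(1)
proof (induction k)
  case 0
  have "ish_partial q n 0 = {n} \<rightarrow>\<^sub>E {0..<int q}" by (simp add: ish_partial_def)
  then show ?case by (simp add: card_PiE)
next
  case (Suc k)
  define F where "F = (\<lambda>x :: nat \<Rightarrow> int. {0..<int q} - (x ` {1..k} \<union> block q (x n) (n - Suc k)))"
  have S: "{1..Suc k} = insert (Suc k) {1..k}" by auto
  have A: "insert n {1..Suc k} = insert (Suc k) (insert n {1..k})" by auto
  have "card (ish_partial q n (Suc k)) = card (ish_partial q n k) * (q - n)"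
  proof (rule card_PiE_extend[where F = F and B = "{0..<int q}"])
    show "Suc k \<notin> insert n {1..k}" using Suc.prems by auto
    show "ish_partial q n k \<subseteq> insert n {1..k} \<rightarrow>\<^sub>E {0..<int q}" by (auto simp: ish_partial_def)
    show "finite (ish_partial q n k)" by (rule finite_ish_partial)
    show "ish_partial q n (Suc k) \<subseteq> insert (Suc k) (insert n {1..k}) \<rightarrow>\<^sub>E {0..<int q}"
      unfolding ish_partial_def A by blast
  next
    fix x c assume x: "x \<in> insert n {1..k} \<rightarrow>\<^sub>E {0..<int q}" and c: "c \<in> {0..<int q}"
    let ?y = "x(Suc k := c)"
    have P: "?y \<in> insert n {1..Suc k} \<rightarrow>\<^sub>E {0..<int q}"
      using x c unfolding A by (auto simp: PiE_def Pi_def extensional_def)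
    have n: "?y n = x n" using Suc.prems by simp
    have im: "?y ` {1..k} = x ` {1..k}" by auto
    have "inj_on ?y {1..Suc k} \<longleftrightarrow> inj_on ?y {1..k} \<and> ?y (Suc k) \<notin> ?y ` {1..k}"
      unfolding S by (subst inj_on_insert) simp
    moreover have "inj_on ?y {1..k} \<longleftrightarrow> inj_on x {1..k}" by (rule inj_on_cong) auto
    moreover have "(\<forall>i\<in>{1..Suc k}. ?y i \<notin> block q (?y n) (n - i)) \<longleftrightarrow>
        c \<notin> block q (x n) (n - Suc k) \<and> (\<forall>i\<in>{1..k}. x i \<notin> block q (x n) (n - i))"
      unfolding S n by auto
    ultimately show "?y \<in> ish_partial q n (Suc k) \<longleftrightarrow> x \<in> ish_partial q n k \<and> c \<in> F x"
      using x c P unfolding ish_partial_def F_def im by auto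
  next
    fix x assume x: "x \<in> ish_partial q n k"
    have disj: "x ` {1..k} \<inter> block q (x n) (n - Suc k) = {}"
    proof -
      have "x i \<notin> block q (x n) (n - Suc k)" if i: "i \<in> {1..k}" for i
      proof -
        have "n - Suc k \<le> n - i" using i by auto
        then show ?thesis using x i block_mono[of "n - Suc k" "n - i" q "x n"] unfolding ish_partial_def by auto
      qed
      then show ?thesis by blast
    qed
    have sub: "x ` {1..k} \<union> block q (x n) (n - Suc k) \<subseteq> {0..<int q}"
      using x assms(2) block_subset[of q] unfolding ish_partial_def by auto
    have "card (x ` {1..k} \<union> block q (x n) (n - Suc k)) = card (x ` {1..k}) + card (block q (x n) (n - Suc k))"
      by (rule card_Un_disjoint[OF _ _ disj]) (auto simp: block_def)
    also have "\<dots> = k + Suc (n - Suc k)"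
      using x assms(2) card_block[of "n - Suc k" q "x n"] by (simp add: ish_partial_def card_image)
    also have "\<dots> = n" using Suc.prems by simp
    finally have "card (F x) = q - n"
      unfolding F_def using card_Diff_subset[OF finite_subset[OF sub] sub] by simp
    then show "F x \<subseteq> {0..<int q} \<and> finite (F x) \<and> card (F x) = q - n" by (auto simp: F_def)
  qed
  then show ?case using Suc by simp
qed

lemma card_ish_colourings:
  assumes n: "n \<ge> 1" and q: "n < q"
  shows "card (colourings q {1..n} (ish_edges n)) = q * (q - n) ^ (n - 1)"
proof -
  have V: "insert n {1..n - 1} = {1..n}" using n by auto
  have "x \<in> colourings q {1..n} (ish_edges n) \<longleftrightarrow> x \<in> ish_partial q n (n - 1)"
    if x: "x \<in> {1..n} \<rightarrow>\<^sub>E {0..<int q}" for x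
  proof -
    have b: "0 \<le> x i" "x i < int q" if "i \<in> {1..n}" for i using x that by auto
    have eq: "int q dvd x i - x j - a \<longleftrightarrow> x i = (x j + a) mod int q" if "i \<in> {1..n}" for i j a
      using dvd_diff_iff_eq_mod[OF b[OF that], of "x j + a"] by (simp add: diff_diff_eq)
    have md: "x i mod int q = x i" if "i \<in> {1..n}" for i using b[OF that] by simp
    show ?thesis
    proof
      assume c: "x \<in> colourings q {1..n} (ish_edges n)"
      have ne: "x i \<noteq> x j" if "1 \<le> i" "i < j" "j \<le> n" for i j
      proof -
        have "(i, j, 0) \<in> ish_edges n" using that by (simp add: ish_edges_def)
        then have "\<not> int q dvd x i - x j - 0" using c unfolding colourings_def by fast
        then show ?thesis by auto
      qed
      have "inj_on x {1..n - 1}"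
      proof (rule inj_onI, rule ccontr)
        fix i j assume ij: "i \<in> {1..n - 1}" "j \<in> {1..n - 1}" "x i = x j" and "i \<noteq> j"
        then consider "i < j" | "j < i" by linarith
        moreover have "1 \<le> i" "i \<le> n" "1 \<le> j" "j \<le> n" using ij by auto
        ultimately show False using ne[of i j] ne[of j i] ij(3) by cases auto
      qed
      moreover have "x i \<noteq> (x n + int a) mod int q" if i: "i \<in> {1..n - 1}" and a: "a \<le> n - i" for i a
      proof (cases "a = 0")
        case True
        have "i < n" using i by (cases n) auto
        then show ?thesis using True ne[of i n] i md[of n] n by auto
      next
        case False
        have "i < n" using i by (cases n) auto
        then have "(i, n, int a) \<in> ish_edges n" using i a \<open>i < n\<close> by (auto simp: ish_edges_def)
        then have "\<not> int q dvd x i - x n - int a" using c unfolding colourings_def by fast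
        then show ?thesis using eq[of i n "int a"] i \<open>i < n\<close> by auto
      qed
      ultimately show "x \<in> ish_partial q n (n - 1)"
        unfolding ish_partial_def V block_def using x by auto
    next
      assume p: "x \<in> ish_partial q n (n - 1)"
      have ne: "x i \<noteq> (x n + int a) mod int q" if "i \<in> {1..n - 1}" "a \<le> n - i" for i a
        using p that unfolding ish_partial_def block_def by fastforce
      have "\<not> int q dvd x i - x j - a" if e: "(i, j, a) \<in> ish_edges n" for i j a
      proof -
        have ij: "1 \<le> i" "i < j" "j \<le> n" and a: "a = 0 \<or> j = n \<and> a \<in> {1..int (n - i)}"
          using e unfolding ish_edges_def by auto
        show ?thesis
        proof (cases "j = n")
          case True
          then have "0 \<le> a" "nat a \<le> n - i" using a by auto
          then show ?thesis using ne[of i "nat a"] ij True eq[of i n a] by auto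
        next
          case False
          then have "i \<in> {1..n - 1}" "j \<in> {1..n - 1}" using ij by auto
          moreover have "inj_on x {1..n - 1}" using p unfolding ish_partial_def by blast
          ultimately have "x i \<noteq> x j" using inj_onD[of x "{1..n - 1}" i j] ij by auto
          then show ?thesis using a False eq[of i j 0] md[of j] ij by auto
        qed
      qed
      then show "x \<in> colourings q {1..n} (ish_edges n)" using x unfolding colourings_def by auto
    qed
  qed
  moreover have "colourings q {1..n} (ish_edges n) \<subseteq> {1..n} \<rightarrow>\<^sub>E {0..<int q}"
    unfolding colourings_def by blast
  moreover have "ish_partial q n (n - 1) \<subseteq> {1..n} \<rightarrow>\<^sub>E {0..<int q}"
    unfolding ish_partial_def V by blast
  ultimately have "colourings q {1..n} (ish_edges n) = ish_partial q n (n - 1)"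
    by blast
  then show ?thesis using card_ish_partial[of "n - 1" n q] n q by simp
qed

section \<open>Counting colourings for Shi\<close>

text \<open>
  The order in which labels are met on the circle: first by gap, and by label within a gap.
\<close>

definition lex_less :: "(nat \<Rightarrow> int) \<Rightarrow> nat \<Rightarrow> nat \<Rightarrow> bool" where
  "lex_less f j i \<longleftrightarrow> f j < f i \<or> f j = f i \<and> j < i"

text \<open>
  The seat of a label \<open>i\<close> that has been assigned to gap \<open>f i\<close>: before it, starting from the empty
  seat \<open>0\<close>, there are \<open>f i + 1\<close> empty seats and all labels preceding \<open>i\<close>.
\<close>

definition place :: "nat \<Rightarrow> (nat \<Rightarrow> int) \<Rightarrow> nat \<Rightarrow> int" where
  "place n f = (\<lambda>i\<in>{1..n}. f i + 1 + int (card {j\<in>{1..n}. lex_less f j i}))"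

text \<open>
  The inverse of \<open>place\<close>: the number of empty seats between seat \<open>0\<close> and the seat of \<open>i\<close>.
\<close>

definition gap :: "nat \<Rightarrow> (nat \<Rightarrow> int) \<Rightarrow> nat \<Rightarrow> int" where
  "gap n x = (\<lambda>i\<in>{1..n}. x i - 1 - int (card {j\<in>{1..n}. x j < x i}))"

text \<open>
  Shi colourings that leave seat \<open>0\<close> empty (see \<open>placements_eq\<close>). As \<open>0\<close> is not taken, no run of
  occupied seats wraps around, and congruences become equations.
\<close>

definition placements :: "nat \<Rightarrow> nat \<Rightarrow> (nat \<Rightarrow> int) set" where
  "placements q n = {x \<in> {1..n} \<rightarrow>\<^sub>E {1..<int q}. inj_on x {1..n} \<and>
     (\<forall>i\<in>{1..n}. \<forall>j\<in>{1..n}. i < j \<longrightarrow> x i \<noteq> x j + 1)}"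

lemma place_less:
  assumes "i \<in> {1..n}" "j \<in> {1..n}" "lex_less f j i"
  shows "place n f j < place n f i" "f j < f i \<Longrightarrow> place n f j + 1 < place n f i"
proof -
  \<comment> \<open>The rank in the lexicographic order is strictly increasing.\<close>
  have "{k\<in>{1..n}. lex_less f k j} \<subset> {k\<in>{1..n}. lex_less f k i}"
    using assms unfolding lex_less_def by auto
  then have "card {k\<in>{1..n}. lex_less f k j} < card {k\<in>{1..n}. lex_less f k i}"
    by (intro psubset_card_mono) auto
  then show "place n f j < place n f i" "f j < f i \<Longrightarrow> place n f j + 1 < place n f i"
    using assms unfolding place_def by (auto simp: lex_less_def)
qed

lemma lex_less_total: "i \<noteq> j \<Longrightarrow> lex_less f i j \<or> lex_less f j i"
  unfolding lex_less_def by auto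

lemma place_less_iff:
  assumes "i \<in> {1..n}" "j \<in> {1..n}"
  shows "place n f j < place n f i \<longleftrightarrow> lex_less f j i"
  using place_less(1)[OF assms, of f] place_less(1)[OF assms(2,1), of f] lex_less_total[of i j f]
  by (metis less_asym less_irrefl)

lemma place_in_placements:
  assumes f: "f \<in> {1..n} \<rightarrow>\<^sub>E {0..<int q - int n}"
  shows "place n f \<in> placements q n"
proof -
  have "place n f i \<in> {1..<int q}" if i: "i \<in> {1..n}" for i
  proof -
    have "{j\<in>{1..n}. lex_less f j i} \<subseteq> {1..n} - {i}" unfolding lex_less_def by blast
    then have "card {j\<in>{1..n}. lex_less f j i} \<le> card ({1..n} - {i})" by (rule card_mono[rotated]) simp
    then have "card {j\<in>{1..n}. lex_less f j i} \<le> n - 1" using i by simp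
    moreover have "n \<ge> 1" using i by simp
    ultimately have "card {j\<in>{1..n}. lex_less f j i} < n" by linarith
    moreover have "0 \<le> f i" "f i < int q - int n" using f i by auto
    ultimately show ?thesis using i by (auto simp: place_def)
  qed
  then have "place n f \<in> {1..n} \<rightarrow>\<^sub>E {1..<int q}" by (auto simp: place_def)
  moreover have "inj_on (place n f) {1..n}"
    using lex_less_total place_less(1) by (metis inj_onI less_irrefl)
  moreover have "place n f i \<noteq> place n f j + 1" if "i \<in> {1..n}" "j \<in> {1..n}" "i < j" for i j
  proof
    assume eq: "place n f i = place n f j + 1"
    then have lt: "lex_less f j i" using place_less_iff[OF that(1,2), of f] by simp
    then have "f j < f i" using that(3) by (auto simp: lex_less_def)
    then show False using place_less(2)[OF that(1,2) lt] eq by simp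
  qed
  ultimately show ?thesis unfolding placements_def by blast
qed

lemma gap_place:
  assumes f: "f \<in> {1..n} \<rightarrow>\<^sub>E {0..<int q - int n}"
  shows "gap n (place n f) = f"
proof
  fix i
  show "gap n (place n f) i = f i"
  proof (cases "i \<in> {1..n}")
    case True
    then have "{j\<in>{1..n}. place n f j < place n f i} = {j\<in>{1..n}. lex_less f j i}"
      using place_less_iff by blast
    then show ?thesis using True by (simp add: gap_def) (simp add: place_def)
  next
    case False
    then show ?thesis using f by (auto simp: gap_def PiE_def extensional_def)
  qed
qed

text \<open>
  There are at most \<open>x i - 1\<close> seats for the labels before \<open>i\<close> and at most \<open>q - 1 - x i\<close> for those
  after it.
\<close>

lemma gap_bounds:
  assumes x: "x \<in> placements q n" and i: "i \<in> {1..n}"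
  shows "gap n x i \<in> {0..<int q - int n}"
proof -
  have inj: "inj_on x {1..n}" and r: "\<And>j. j \<in> {1..n} \<Longrightarrow> 1 \<le> x j \<and> x j < int q"
    using x unfolding placements_def by auto
  let ?L = "{j\<in>{1..n}. x j < x i}" and ?G = "{j\<in>{1..n}. x i < x j}"
  have "card ?L = card (x ` ?L)" by (rule card_image[symmetric]) (rule inj_on_subset[OF inj], blast)
  also have "\<dots> \<le> card {1..<x i}" by (rule card_mono) (use r in auto)
  finally have "card ?L \<le> nat (x i - 1)" by simp
  then have L: "int (card ?L) \<le> x i - 1" using r[OF i] by linarith
  have "card ?G = card (x ` ?G)" by (rule card_image[symmetric]) (rule inj_on_subset[OF inj], blast)
  also have "\<dots> \<le> card {x i<..<int q}" by (rule card_mono) (use r in auto)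
  finally have "card ?G \<le> nat (int q - (x i + 1))" by simp
  then have G: "int (card ?G) \<le> int q - 1 - x i" using r[OF i] by linarith
  have "j \<in> insert i (?L \<union> ?G)" if j: "j \<in> {1..n}" for j
  proof (cases "x j = x i")
    case True
    then show ?thesis using inj_onD[OF inj True j i] by simp
  next
    case False
    then show ?thesis using j by (simp add: neq_iff)
  qed
  then have "{1..n} = insert i (?L \<union> ?G)" using i by blast
  then have "n = card (insert i (?L \<union> ?G))" by (metis card_atLeastAtMost diff_Suc_1)
  also have "\<dots> = Suc (card ?L + card ?G)"
    by (subst card_insert_disjoint) (auto intro!: card_Un_disjoint)
  finally show ?thesis using L G i by (simp add: gap_def)
qed

text \<open>
  Along consecutive occupied seats the label increases from one seat to the next; the proof walks
  from the seat of \<open>j\<close> to that of \<open>i\<close>.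
\<close>

lemma placements_run_increasing:
  assumes x: "x \<in> placements q n" and ij: "i \<in> {1..n}" "j \<in> {1..n}" "x j < x i"
    and full: "{x j..<x i} \<subseteq> x ` {1..n}"
  shows "j < i"
proof -
  have "\<exists>k\<in>{1..n}. x k = x j + int d \<and> j \<le> k" if "int d \<le> x i - x j" for d
    using that
  proof (induction d)
    case 0
    then show ?case using ij by auto
  next
    case (Suc d)
    then obtain k where k: "k \<in> {1..n}" "x k = x j + int d" "j \<le> k" by auto
    obtain l where l: "l \<in> {1..n}" "x l = x j + int (Suc d)"
    proof (cases "int (Suc d) = x i - x j")
      case True
      then show ?thesis using that[of i] ij by simp
    next
      case False
      then have "x j + int (Suc d) \<in> {x j..<x i}" using Suc.prems by auto
      then have "x j + int (Suc d) \<in> x ` {1..n}" using full by blast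
      then show ?thesis using that by fastforce
    qed
    have "x l = x k + 1" using k l by simp
    then have "\<not> l < k" using x k(1) l(1) unfolding placements_def by blast
    then show ?case using l k(3) by (intro bexI[of _ l]) auto
  qed
  from this[of "nat (x i - x j)"] obtain k where k: "k \<in> {1..n}" "x k = x i" "j \<le> k"
    using ij(3) by auto
  then have "k = i" using x ij(1) unfolding placements_def inj_on_def by blast
  then show ?thesis using k(3) ij(3) by (cases "j = i") auto
qed

text \<open>
  The number of empty seats is weakly increasing along the circle. It is the same for two labels
  only if all seats between them are occupied, and then the labels are in increasing order.
\<close>

lemma lex_less_gap:
  assumes x: "x \<in> placements q n" and ij: "i \<in> {1..n}" "j \<in> {1..n}" "x j < x i"
  shows "lex_less (gap n x) j i"
proof -
  have inj: "inj_on x {1..n}" using x unfolding placements_def by blast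
  let ?M = "{k\<in>{1..n}. x j \<le> x k \<and> x k < x i}"
  have im: "card (x ` ?M) = card ?M" by (rule card_image) (rule inj_on_subset[OF inj], blast)
  have sub: "x ` ?M \<subseteq> {x j..<x i}" by auto
  have "{k\<in>{1..n}. x k < x i} = {k\<in>{1..n}. x k < x j} \<union> ?M" using ij(3) by auto
  then have "card {k\<in>{1..n}. x k < x i} = card ({k\<in>{1..n}. x k < x j} \<union> ?M)" by (rule arg_cong)
  also have "\<dots> = card {k\<in>{1..n}. x k < x j} + card ?M"
    by (rule card_Un_disjoint) auto
  finally have diff: "gap n x i - gap n x j = x i - x j - int (card ?M)"
    using ij by (simp add: gap_def)
  have "card (x ` ?M) \<le> card {x j..<x i}" by (rule card_mono) (use sub in auto)
  then have le: "gap n x j \<le> gap n x i" using diff im ij(3) by simp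
  show ?thesis
  proof (cases "gap n x j = gap n x i")
    case True
    then have "card (x ` ?M) = card {x j..<x i}" using diff im ij(3) by simp
    then have "x ` ?M = {x j..<x i}" by (intro card_subset_eq sub) auto
    then have "{x j..<x i} \<subseteq> x ` {1..n}" by blast
    then show ?thesis using placements_run_increasing[OF x ij] True by (simp add: lex_less_def)
  next
    case False
    then show ?thesis using le by (simp add: lex_less_def)
  qed
qed

lemma place_gap:
  assumes x: "x \<in> placements q n"
  shows "place n (gap n x) = x"
proof
  fix i
  have inj: "inj_on x {1..n}" using x unfolding placements_def by blast
  show "place n (gap n x) i = x i"
  proof (cases "i \<in> {1..n}")
    case True
    have "lex_less (gap n x) j i \<longleftrightarrow> x j < x i" if j: "j \<in> {1..n}" for j
    proof
      assume l: "lex_less (gap n x) j i"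
      then have "j \<noteq> i" "\<not> lex_less (gap n x) i j" by (auto simp: lex_less_def)
      then have "x j \<noteq> x i" "\<not> x i < x j"
        using inj_onD[OF inj _ j True] lex_less_gap[OF x j True] by auto
      then show "x j < x i" by simp
    qed (rule lex_less_gap[OF x True j])
    then have "{j\<in>{1..n}. lex_less (gap n x) j i} = {j\<in>{1..n}. x j < x i}" by blast
    then show ?thesis using True by (simp add: place_def) (simp add: gap_def)
  next
    case False
    then show ?thesis using x by (auto simp: place_def placements_def PiE_def extensional_def)
  qed
qed

lemma card_placements:
  assumes "n < q"
  shows "card (placements q n) = (q - n) ^ n"
proof -
  have bij: "bij_betw (place n) ({1..n} \<rightarrow>\<^sub>E {0..<int q - int n}) (placements q n)"
  proof (rule bij_betw_byWitness[where f' = "gap n"])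
    show "gap n ` placements q n \<subseteq> {1..n} \<rightarrow>\<^sub>E {0..<int q - int n}"
      using gap_bounds by (force simp: gap_def)
  qed (use gap_place place_gap place_in_placements in blast)+
  have "card (placements q n) = card ({1..n} \<rightarrow>\<^sub>E {0..<int q - int n})"
    by (rule bij_betw_same_card[OF bij, symmetric])
  then show ?thesis using assms by (simp add: card_PiE nat_diff_distrib')
qed

lemma placements_eq:
  "placements q n = {x \<in> colourings q {1..n} (shi_edges n). 0 \<notin> x ` {1..n}}"
proof -
  have "x \<in> placements q n \<longleftrightarrow> x \<in> colourings q {1..n} (shi_edges n)"
    if x: "x \<in> {1..n} \<rightarrow>\<^sub>E {1..<int q}" for x
  proof -
    have b: "1 \<le> x i" "x i < int q" if "i \<in> {1..n}" for i using x that by auto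
    have eq: "int q dvd x i - x j - a \<longleftrightarrow> x i = x j + a"
      if "i \<in> {1..n}" "j \<in> {1..n}" "a \<in> {0, 1}" for i j a
    proof
      assume "int q dvd x i - x j - a"
      moreover have "\<bar>x i - x j - a\<bar> < int q" using b[OF that(1)] b[OF that(2)] that(3) by auto
      ultimately show "x i = x j + a" using dvd_imp_le_int[of "x i - x j - a" "int q"] by force
    qed simp
    have "x \<in> colourings q {1..n} (shi_edges n) \<longleftrightarrow>
        (\<forall>i\<in>{1..n}. \<forall>j\<in>{1..n}. i < j \<longrightarrow> x i \<noteq> x j \<and> x i \<noteq> x j + 1)"
    proof -
      have "x \<in> {1..n} \<rightarrow>\<^sub>E {0..<int q}" using x by (force simp: PiE_def Pi_def)
      then have "x \<in> colourings q {1..n} (shi_edges n) \<longleftrightarrow>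
          (\<forall>i\<in>{1..n}. \<forall>j\<in>{1..n}. i < j \<longrightarrow> (\<forall>a\<in>{0, 1}. \<not> int q dvd x i - x j - a))"
        unfolding colourings_def shi_edges_def by fastforce
      then show ?thesis using eq by auto
    qed
    moreover have "inj_on x {1..n} \<longleftrightarrow> (\<forall>i\<in>{1..n}. \<forall>j\<in>{1..n}. i < j \<longrightarrow> x i \<noteq> x j)"
      unfolding inj_on_def by (metis nat_neq_iff)
    ultimately show ?thesis using x unfolding placements_def by blast
  qed
  moreover have "x \<in> {1..n} \<rightarrow>\<^sub>E {1..<int q}"
    if "x \<in> colourings q {1..n} (shi_edges n)" "0 \<notin> x ` {1..n}" for x
  proof -
    have x: "x \<in> {1..n} \<rightarrow>\<^sub>E {0..<int q}" using that(1) unfolding colourings_def by blast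
    have "x i \<in> {1..<int q}" if i: "i \<in> {1..n}" for i
    proof -
      have "0 \<le> x i" "x i < int q" "x i \<noteq> 0" using x i \<open>0 \<notin> x ` {1..n}\<close> by (auto simp: image_iff)
      then show ?thesis by simp
    qed
    then show ?thesis using x by (auto simp: PiE_def)
  qed
  moreover have "x \<in> {1..n} \<rightarrow>\<^sub>E {1..<int q} \<and> 0 \<notin> x ` {1..n}" if "x \<in> placements q n" for x
  proof -
    have x: "x \<in> {1..n} \<rightarrow>\<^sub>E {1..<int q}" using that unfolding placements_def by blast
    then have "x ` {1..n} \<subseteq> {1..<int q}" by blast
    moreover have "0 \<notin> {1..<int q}" by simp
    ultimately show ?thesis using x by blast
  qed
  ultimately show ?thesis by blast
qed

lemma shi_colourings_inj:
  assumes "x \<in> colourings q {1..n} (shi_edges n)"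
  shows "inj_on x {1..n}"
proof -
  have "x i \<noteq> x j" if "1 \<le> i" "i < j" "j \<le> n" for i j
  proof -
    have "(i, j, 0) \<in> shi_edges n" using that by (simp add: shi_edges_def)
    then have "\<not> int q dvd x i - x j - 0" using assms unfolding colourings_def by fast
    then show ?thesis by auto
  qed
  then show ?thesis unfolding inj_on_def by (metis atLeastAtMost_iff nat_neq_iff)
qed

text \<open>
  Double counting of the pairs of a colouring \<open>x\<close> and a seat \<open>c\<close> that it leaves empty. Every
  colouring leaves \<open>q - n\<close> seats empty; on the other hand, rotating by \<open>-c\<close> turns the pair into a
  colouring leaving seat \<open>0\<close> empty, together with the arbitrary residue \<open>c\<close>.
\<close>

lemma card_shi_colourings:
  assumes n: "n \<ge> 1" and q: "n < q"
  shows "card (colourings q {1..n} (shi_edges n)) = q * (q - n) ^ (n - 1)"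
proof -
  define K where "K = colourings q {1..n} (shi_edges n)"
  define sh where "sh = (\<lambda>t x. \<lambda>i\<in>{1..n}. (x i + t) mod int q)"
  have finK: "finite K" unfolding K_def by (rule finite_colourings) simp
  have KP: "x \<in> {1..n} \<rightarrow>\<^sub>E {0..<int q}" if "x \<in> K" for x using that unfolding K_def colourings_def by blast
  have sh_K: "sh t x \<in> K" if x: "x \<in> K" for t x
  proof -
    have "\<not> int q dvd sh t x i - sh t x j - a" if e: "(i, j, a) \<in> shi_edges n" for i j a
    proof -
      have "\<not> int q dvd x i - x j - a" using x e unfolding K_def colourings_def by fast
      then show ?thesis using e by (simp add: sh_def shi_edges_def shift_dvd_iff)
    qed
    then show ?thesis using q unfolding K_def colourings_def by (auto simp: sh_def)
  qed
  have sh_sh: "sh t (sh s x) = x" if x: "x \<in> K" and st: "s + t = 0" for s t x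
  proof
    fix i
    show "sh t (sh s x) i = x i"
    proof (cases "i \<in> {1..n}")
      case True
      then have "0 \<le> x i" "x i < int q" using KP[OF x] by auto
      moreover have "((x i + s) mod int q + t) mod int q = (x i + (s + t)) mod int q"
        by (simp add: mod_add_left_eq add.assoc)
      ultimately show ?thesis using True st by (simp add: sh_def)
    next
      case False
      then show ?thesis using KP[OF x] by (auto simp: sh_def PiE_def extensional_def)
    qed
  qed
  have zero: "0 \<in> sh (- c) x ` {1..n} \<longleftrightarrow> c \<in> x ` {1..n}" if x: "x \<in> K" and c: "c \<in> {0..<int q}" for x c
  proof -
    have "sh (- c) x i = 0 \<longleftrightarrow> x i = c" if i: "i \<in> {1..n}" for i
    proof -
      have "0 \<le> x i" "x i < int q" using KP[OF x] i by auto
      then have "int q dvd x i - c \<longleftrightarrow> x i = c" using dvd_diff_iff_eq_mod[of "x i" "int q" c] c by simp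
      then show ?thesis using i by (simp add: sh_def dvd_eq_mod_eq_0)
    qed
    then show ?thesis by (metis (no_types, lifting) image_iff)
  qed
  let ?T = "Sigma K (\<lambda>x. {0..<int q} - x ` {1..n})"
  have bij: "bij_betw (\<lambda>(x, c). (c, sh (- c) x)) ?T ({0..<int q} \<times> placements q n)"
  proof (rule bij_betw_byWitness[where f' = "\<lambda>(c, y). (sh c y, c)"])
    show "\<forall>p\<in>?T. (case (case p of (x, c) \<Rightarrow> (c, sh (- c) x)) of (c, y) \<Rightarrow> (sh c y, c)) = p"
      using sh_sh by auto
    show "\<forall>p\<in>{0..<int q} \<times> placements q n.
        (case (case p of (c, y) \<Rightarrow> (sh c y, c)) of (x, c) \<Rightarrow> (c, sh (- c) x)) = p"
      using sh_sh unfolding placements_eq K_def[symmetric] by auto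
    show "(\<lambda>(x, c). (c, sh (- c) x)) ` ?T \<subseteq> {0..<int q} \<times> placements q n"
    proof
      fix p assume "p \<in> (\<lambda>(x, c). (c, sh (- c) x)) ` ?T"
      then obtain x c where p: "p = (c, sh (- c) x)"
        and x: "x \<in> K" and c: "c \<in> {0..<int q}" "c \<notin> x ` {1..n}" by auto
      then have "sh (- c) x \<in> placements q n"
        using sh_K[OF x] zero[OF x c(1)] unfolding placements_eq K_def[symmetric] by blast
      then show "p \<in> {0..<int q} \<times> placements q n" using p c(1) by blast
    qed
    show "(\<lambda>(c, y). (sh c y, c)) ` ({0..<int q} \<times> placements q n) \<subseteq> ?T"
    proof
      fix p assume "p \<in> (\<lambda>(c, y). (sh c y, c)) ` ({0..<int q} \<times> placements q n)"
      then obtain c y where p: "p = (sh c y, c)" and c: "c \<in> {0..<int q}" and "y \<in> placements q n"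
        by auto
      then have y: "y \<in> K" "0 \<notin> y ` {1..n}" unfolding placements_eq K_def[symmetric] by blast+
      have "c \<notin> sh c y ` {1..n}"
        using zero[OF sh_K[OF y(1), of c] c] sh_sh[OF y(1), of c "- c"] y(2) by simp
      then show "p \<in> ?T" using sh_K[OF y(1)] c p by blast
    qed
  qed
  have "card ?T = card ({0..<int q} \<times> placements q n)"
    by (rule bij_betw_same_card[OF bij])
  then have total: "card ?T = q * (q - n) ^ n"
    using card_placements[OF q] by (simp add: card_cartesian_product)
  have "card ?T = card K * (q - n)"
  proof -
    have "card ({0..<int q} - x ` {1..n}) = q - n" if x: "x \<in> K" for x
    proof -
      have "x ` {1..n} \<subseteq> {0..<int q}" using KP[OF x] by auto
      then have "card ({0..<int q} - x ` {1..n}) = q - card (x ` {1..n})"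
        by (simp add: card_Diff_subset)
      then show ?thesis using shi_colourings_inj[OF x[unfolded K_def]] by (simp add: card_image)
    qed
    then show ?thesis using finK by (simp add: card_SigmaI)
  qed
  with total have "card K * (q - n) = q * (q - n) ^ n" by simp
  also have "\<dots> = (q * (q - n) ^ (n - 1)) * (q - n)"
    using n by (cases n) simp_all
  finally show ?thesis using q unfolding K_def by simp
qed

section \<open>Chambers of the Shi and Ish arrangements\<close>

lemma connected_on_complete:
  fixes E :: "nat edge set"
  assumes "\<And>i j. 1 \<le> i \<Longrightarrow> i < j \<Longrightarrow> j \<le> n \<Longrightarrow> (i, j, 0) \<in> E"
  shows "connected_on {1..n} E"
  unfolding connected_on_def
proof (intro allI impI)
  fix S assume S: "S \<subseteq> {1..n}" "S \<noteq> {}" "\<forall>(i, j, a)\<in>E. i \<in> S \<longleftrightarrow> j \<in> S"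
  obtain u where u: "u \<in> S" using S(2) by blast
  have "v \<in> S" if v: "v \<in> {1..n}" for v
  proof (rule linorder_cases[of u v])
    assume "u < v"
    then have "(u, v, 0) \<in> E" using assms u v S(1) by auto
    then show "v \<in> S" using S(3) u by fast
  next
    assume "v < u"
    then have "(v, u, 0) \<in> E" using assms u v S(1) by auto
    then show "v \<in> S" using S(3) u by fast
  qed (use u in simp)
  then show "S = {1..n}" using S(1) by blast
qed

text \<open>
  The edges of weight \<open>0\<close> make \<open>E\<close> connected, so both counts are given by evaluating
  \<open>Q(q) = q (q - n)\<^bsup>n-1\<^esup>\<close> at \<open>-1\<close> and at \<open>1\<close>.
\<close>

lemma chamber_counts:
  assumes n: "n \<ge> 1" and fin: "finite E" and E: "E \<subseteq> {1..n} \<times> {1..n} \<times> UNIV"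
    and loops: "\<And>i. (i, i, 0) \<notin> E"
    and braid: "\<And>i j. 1 \<le> i \<Longrightarrow> i < j \<Longrightarrow> j \<le> n \<Longrightarrow> (i, j, 0) \<in> E"
    and count: "\<And>q. n < q \<Longrightarrow> card (colourings q {1..n} E) = q * (q - n) ^ (n - 1)"
  shows "card (chambers (rn0 n) (induced n (arrangement n E))) = (n + 1) ^ (n - 1)"
    and "card {C \<in> chambers (rn0 n) (induced n (arrangement n E)). rn0_bounded n C} = (n - 1) ^ (n - 1)"
proof -
  define Q where "Q = pCons 0 ([:- int n, 1:] ^ (n - 1))"
  obtain m where m: "n = Suc m" using n by (cases n) auto
  have "is_charpoly {1..n} E Q"
    unfolding is_charpoly_def using eventually_gt_at_top[of n]
  proof eventually_elim
    case (elim q)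
    then show ?case using count[OF elim] by (simp add: Q_def poly_power of_nat_diff)
  qed
  note z = zaslavsky_charpoly[OF _ _ fin E loops this]
  have "int (card (regions E)) = (- 1) ^ n * poly Q (- 1)" using z(1) n by simp
  also have "\<dots> = (- 1) ^ m * (- 1 - int n) ^ m" by (simp add: Q_def poly_power m)
  also have "\<dots> = int ((n + 1) ^ (n - 1))"
    unfolding power_mult_distrib[symmetric] by (simp add: m add.commute)
  finally have "card (regions E) = (n + 1) ^ (n - 1)" by (simp only: of_nat_eq_iff)
  then show "card (chambers (rn0 n) (induced n (arrangement n E))) = (n + 1) ^ (n - 1)"
    by (simp only: card_chambers(1)[OF fin E n])
  have "int (bounded_count {1..n} E) = (- 1) ^ (n - 1) * poly Q 1"
    using z(2) connected_on_complete[of n E] braid n by simp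
  also have "\<dots> = (- 1) ^ m * (1 - int n) ^ m" by (simp add: Q_def poly_power m)
  also have "\<dots> = int ((n - 1) ^ (n - 1))"
    unfolding power_mult_distrib[symmetric] by (simp add: m)
  finally have "bounded_count {1..n} E = (n - 1) ^ (n - 1)" by (simp only: of_nat_eq_iff)
  then show "card {C \<in> chambers (rn0 n) (induced n (arrangement n E)). rn0_bounded n C} = (n - 1) ^ (n - 1)"
    by (simp only: card_chambers(2)[OF fin E n])
qed

lemma arrangement_shi: "arrangement n (shi_edges n) = Shi n"
proof
  show "arrangement n (shi_edges n) \<subseteq> Shi n"
    unfolding arrangement_def shi_edges_def Shi_def by fastforce
  show "Shi n \<subseteq> arrangement n (shi_edges n)"
  proof
    fix H assume "H \<in> Shi n"
    then obtain i j a where H: "H = hyp n i j a" "1 \<le> i" "i < j" "j \<le> n" "a = 0 \<or> a = 1"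
      unfolding Shi_def by blast
    define b :: int where "b = (if a = 0 then 0 else 1)"
    have "(i, j, b) \<in> shi_edges n" "a = of_int b" using H by (auto simp: shi_edges_def b_def)
    then show "H \<in> arrangement n (shi_edges n)" unfolding arrangement_def H(1) by force
  qed
qed

lemma arrangement_ish: "arrangement n (ish_edges n) = Ish n"
proof
  show "arrangement n (ish_edges n) \<subseteq> Ish n"
  proof
    fix H assume "H \<in> arrangement n (ish_edges n)"
    then obtain i j a where H: "H = hyp n i j (of_int a)" and e: "(i, j, a) \<in> ish_edges n"
      unfolding arrangement_def by auto
    show "H \<in> Ish n"
    proof (cases "a = 0")
      case True
      then show ?thesis using e H unfolding ish_edges_def Ish_def by auto
    next
      case False
      then have e': "1 \<le> i" "i < n" "j = n" "1 \<le> a" "a \<le> int (n - i)"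
        using e unfolding ish_edges_def by auto
      obtain m where m: "a = int m" using e'(4) zero_le_imp_eq_int[of a] by auto
      have "H = hyp n i n (real m)" unfolding H e'(3) m by simp
      moreover have "i \<le> n - 1" "m \<in> {1..n - i}" using e' m by auto
      ultimately show ?thesis unfolding Ish_def using e'(1) by blast
    qed
  qed
  show "Ish n \<subseteq> arrangement n (ish_edges n)"
  proof
    fix H assume "H \<in> Ish n"
    then consider i j where "H = hyp n i j 0" "1 \<le> i" "i < j" "j \<le> n"
      | i a where "H = hyp n i n (real a)" "1 \<le> i" "i \<le> n - 1" "a \<in> {1..n - i}"
      unfolding Ish_def by blast
    then show "H \<in> arrangement n (ish_edges n)"
    proof cases
      case 1
      then have "(i, j, 0) \<in> ish_edges n" by (simp add: ish_edges_def)
      then show ?thesis unfolding arrangement_def 1(1) by force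
    next
      case 2
      then have "(i, n, int a) \<in> ish_edges n" by (auto simp: ish_edges_def)
      then show ?thesis unfolding arrangement_def 2(1) by force
    qed
  qed
qed

theorem corollary1:
  fixes n :: nat
  assumes "n \<ge> 1"
  shows "card (chambers (rn0 n) (induced n (Shi n))) = (n + 1) ^ (n - 1)
       \<and> card (chambers (rn0 n) (induced n (Ish n))) = (n + 1) ^ (n - 1)
       \<and> card {C \<in> chambers (rn0 n) (induced n (Shi n)). rn0_bounded n C} = (n - 1) ^ (n - 1)
       \<and> card {C \<in> chambers (rn0 n) (induced n (Ish n)). rn0_bounded n C} = (n - 1) ^ (n - 1)"
proof -
  have s: "shi_edges n \<subseteq> {1..n} \<times> {1..n} \<times> {0..int n}" and i: "ish_edges n \<subseteq> {1..n} \<times> {1..n} \<times> {0..int n}"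
    using assms by (auto simp: shi_edges_def ish_edges_def)
  have fin: "finite (shi_edges n)" "finite (ish_edges n)"
    using s i by (auto intro: finite_subset)
  have sub: "shi_edges n \<subseteq> {1..n} \<times> {1..n} \<times> UNIV" "ish_edges n \<subseteq> {1..n} \<times> {1..n} \<times> UNIV"
    using s i by blast+
  have loops: "(k, k, 0) \<notin> shi_edges n" "(k, k, 0) \<notin> ish_edges n" for k
    by (auto simp: shi_edges_def ish_edges_def)
  have braid: "(k, l, 0) \<in> shi_edges n" "(k, l, 0) \<in> ish_edges n" if "1 \<le> k" "k < l" "l \<le> n" for k l
    using that by (auto simp: shi_edges_def ish_edges_def)
  note shi = chamber_counts[OF assms fin(1) sub(1) loops(1) braid(1) card_shi_colourings[OF assms],
      unfolded arrangement_shi]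
  note ish = chamber_counts[OF assms fin(2) sub(2) loops(2) braid(2) card_ish_colourings[OF assms],
      unfolded arrangement_ish]
  show ?thesis
    by (intro conjI shi ish)
qed

end
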